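(* Let $X$ be a path-connected metric space, $x_0\in X$, such that $\mathbf{w}(X)$ is discrete, and let $N\leq\pi_1(X,x_0)$ be a subgroup containing the commutator subgroup of $\pi_1(X,x_0)$. Then $p_N:\widetilde{X}_N\to X$ has the unique path lifting property if and only if $X$ is homotopically Hausdorff relative to $N$. In particular, $p_K:\widetilde{X}_K\to X$ has the unique path lifting property if $K=cl_{C,c_\infty}(N)$.
   Context: A map is a continuous function; $f_{\#}$ denotes the homomorphism induced on fundamental groups. For paths, $\alpha\cdot\beta$ is concatenation and $\alpha^{-}(t)=\alpha(1-t)$. $\mathbf{w}(X)\subseteq X$ is the subspace of points at which $X$ is not semilocally simply connected, i.e. points $x$ having no open neighborhood $U$ for which $\pi_1(U,x)\to\pi_1(X,x)$ is trivial. "Discrete" means discrete in the subspace topology. $X$ is homotopically Hausdorff relative to $H\leq\pi_1(X,x_0)$ if for every $x\in X$, every path $\alpha$ from $x_0$ to $x$, and every $g\in\pi_1(X,x)\setminus H^{\alpha}$, where $H^{\alpha}=[\alpha^{-}]H[\alpha]\leq\pi_1(X,x)$, there is an open neighborhood $U$ of $x$ such that there is no loop $\delta$ in $U$ based at $x$ with $H^{\alpha}g=H^{\alpha}[\delta]$. For a subgroup $K\leq\pi_1(X,x_0)$, $\widetilde{X}_K$ is the set of equivalence classes $K[\alpha]$ of paths $\alpha:[0,1]\to X$ with $\alpha(0)=x_0$, where $\alpha\sim\beta$ iff $\alpha(1)=\beta(1)$ and $[\alpha\cdot\beta^{-}]\in K$, with the topology generated by the sets $B(K[\alpha],U)=\{K[\alpha\cdot\epsilon]\mid\epsilon:[0,1]\to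 U\text{ a path},\ \epsilon(0)=\alpha(1)\}$, $U$ an open neighborhood of $\alpha(1)$ in $X$. The map $p_K:\widetilde{X}_K\to X$ is $p_K(K[\alpha])=\alpha(1)$. A map $f:Y\to X$ has the unique path lifting property if whenever $\alpha,\beta:[0,1]\to Y$ are paths with $\alpha(0)=\beta(0)$ and $f\circ\alpha=f\circ\beta$, then $\alpha=\beta$. Closed subgroups and closure: for a based space $(\mathbb{T},t_0)$, a subgroup $T\leq\pi_1(\mathbb{T},t_0)$ and $g\in\pi_1(\mathbb{T},t_0)$, a subgroup $H\leq\pi_1(X,x_0)$ is $(T,g)$-closed if for every map $f:(\mathbb{T},t_0)\to(X,x_0)$ with $f_{\#}(T)\leq H$ we have $f_{\#}(g)\in H$. The $(T,g)$-closure $cl_{T,g}(H)$ is the intersection of all $(T,g)$-closed subgroups of $\pi_1(X,x_0)$ containing $H$. The test space $\mathbb{H}^+$: let $C_n\subseteq\mathbb{R}^2$ be the circle of radius $\frac1n$ centered at $(\frac1n,0)$, $\mathbb{H}=\bigcup_{n\geq1}C_n$, $b_0=(0,0)$, and $\mathbb{H}^+=\mathbb{H}\cup([-1,0]\times\{0\})$ with basepoint $b_0^+=(-1,0)$. Let $\ell_n$ be the loop based at $b_0$ traversing $C_n$ once counterclockwise, and $\ell_\infty:[0,1]\to\mathbb{H}$ the loop that is $\ell_n$ (linearly reparametrized) on $[\frac{n-1}{n},\frac{n}{n+1}]$ for each $n\geq1$, with $\ell_\infty(1)=b_0$. Let $\iota:[0,1]\to\mathbb{H}^+$, $\iota(t)=(t-1,0)$.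 Put $c_n=[\iota\cdot\ell_n\cdot\iota^{-}]$, $C=\langle c_n\mid n\in\mathbb{N}\rangle\leq\pi_1(\mathbb{H}^+,b_0^+)$, and $c_\infty=[\iota\cdot\ell_\infty\cdot\iota^{-}]$. *)

theory Defs
  imports "HOL-Analysis.Analysis" "HOL-Algebra.Generated_Groups"
begin

definition paths_between :: "'a::topological_space set \<Rightarrow> 'a \<Rightarrow> 'a \<Rightarrow> (real \<Rightarrow> 'a) set" where
  "paths_between X x y =
     {p. path p \<and> path_image p \<subseteq> X \<and> pathstart p = x \<and> pathfinish p = y}"

text \<open>Only values on the unit interval matter: paths agreeing there lie in the same class.\<close>

definition path_class :: "'a::topological_space set \<Rightarrow> (real \<Rightarrow> 'a) \<Rightarrow> (real \<Rightarrow> 'a) set" where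
  "path_class X p = {q. homotopic_paths X p q}"

text \<open>Concatenation of classes of composable paths, not only of loops, so that the same operation
  also expresses conjugation by a path.\<close>

definition class_mult ::
    "'a::topological_space set \<Rightarrow> (real \<Rightarrow> 'a) set \<Rightarrow> (real \<Rightarrow> 'a) set \<Rightarrow> (real \<Rightarrow> 'a) set" where
  "class_mult X c d =
     (\<Union>p\<in>c. \<Union>q\<in>{q \<in> d. pathstart q = pathfinish p}. path_class X (p +++ q))"

definition fundamental_group ::
    "'a::topological_space set \<Rightarrow> 'a \<Rightarrow> (real \<Rightarrow> 'a) set monoid" where
  "fundamental_group X x =
     \<lparr>carrier = path_class X ` paths_between X x x,
      mult = class_mult X,
      one = path_class X (\<lambda>_. x)\<rparr>"

text \<open>For a map \<open>f\<close> into \<open>Y\<close> continuous on the domain and a path class \<open>c\<close>, all members of this union coincide,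
  so it is the single class of \<open>f \<circ> p\<close> for any \<open>p \<in> c\<close>.\<close>

definition induced_hom ::
    "'b::topological_space set \<Rightarrow> ('a \<Rightarrow> 'b) \<Rightarrow> (real \<Rightarrow> 'a) set \<Rightarrow> (real \<Rightarrow> 'b) set" where
  "induced_hom Y f c = (\<Union>p\<in>c. path_class Y (f \<circ> p))"

definition path_conjugate ::
    "'a::topological_space set \<Rightarrow> (real \<Rightarrow> 'a) set set \<Rightarrow> (real \<Rightarrow> 'a) \<Rightarrow> (real \<Rightarrow> 'a) set set" where
  "path_conjugate X H \<alpha> =
     {class_mult X (class_mult X (path_class X (reversepath \<alpha>)) h) (path_class X \<alpha>) | h. h \<in> H}"

definition semilocally_simply_connected_at :: "'a::topological_space set \<Rightarrow> 'a \<Rightarrow> bool" where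
  "semilocally_simply_connected_at X x \<longleftrightarrow>
     (\<exists>U. openin (top_of_set X) U \<and> x \<in> U \<and>
          (\<forall>g \<in> carrier (fundamental_group U x).
             induced_hom X (\<lambda>y. y) g = \<one>\<^bsub>fundamental_group X x\<^esub>))"

definition wild_set :: "'a::topological_space set \<Rightarrow> 'a set" where
  "wild_set X = {x \<in> X. \<not> semilocally_simply_connected_at X x}"

definition homotopically_Hausdorff_rel ::
    "'a::topological_space set \<Rightarrow> 'a \<Rightarrow> (real \<Rightarrow> 'a) set set \<Rightarrow> bool" where
  "homotopically_Hausdorff_rel X x\<^sub>0 H \<longleftrightarrow>
     (\<forall>x \<in> X. \<forall>\<alpha> \<in> paths_between X x\<^sub>0 x.
        \<forall>g \<in> carrier (fundamental_group X x) - path_conjugate X H \<alpha>.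
          \<exists>U. openin (top_of_set X) U \<and> x \<in> U \<and>
              \<not> (\<exists>\<delta> \<in> paths_between U x x.
                     path_conjugate X H \<alpha> #>\<^bsub>fundamental_group X x\<^esub> g =
                     path_conjugate X H \<alpha> #>\<^bsub>fundamental_group X x\<^esub> path_class X \<delta>))"

definition lift_class ::
    "'a::topological_space set \<Rightarrow> 'a \<Rightarrow> (real \<Rightarrow> 'a) set set \<Rightarrow> (real \<Rightarrow> 'a) \<Rightarrow> (real \<Rightarrow> 'a) set" where
  "lift_class X x\<^sub>0 K \<alpha> =
     {\<beta> \<in> paths_between X x\<^sub>0 (pathfinish \<alpha>). path_class X (\<alpha> +++ reversepath \<beta>) \<in> K}"

definition lift_nbhd ::
    "'a::topological_space set \<Rightarrow> 'a \<Rightarrow> (real \<Rightarrow> 'a) set set \<Rightarrow> (real \<Rightarrow> 'a) \<Rightarrow> 'a set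
     \<Rightarrow> (real \<Rightarrow> 'a) set set" where
  "lift_nbhd X x\<^sub>0 K \<alpha> U =
     {lift_class X x\<^sub>0 K (\<alpha> +++ \<epsilon>) | \<epsilon> y. \<epsilon> \<in> paths_between U (pathfinish \<alpha>) y}"

text \<open>The underlying set of this topology consists of all classes of paths in \<open>X\<close> starting at
  \<open>x\<^sub>0\<close>, since \<open>U = X\<close> is allowed.\<close>

definition lift_space ::
    "'a::topological_space set \<Rightarrow> 'a \<Rightarrow> (real \<Rightarrow> 'a) set set \<Rightarrow> (real \<Rightarrow> 'a) set topology" where
  "lift_space X x\<^sub>0 K = topology_generated_by
     {lift_nbhd X x\<^sub>0 K \<alpha> U | \<alpha> x U.
        \<alpha> \<in> paths_between X x\<^sub>0 x \<and> openin (top_of_set X) U \<and> x \<in> U}"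

text \<open>All members of a class have the same endpoint, so the choice is immaterial.\<close>

definition endpoint_proj :: "(real \<Rightarrow> 'a::topological_space) set \<Rightarrow> 'a" where
  "endpoint_proj c = pathfinish (SOME \<alpha>. \<alpha> \<in> c)"

definition unique_path_lifting :: "'b topology \<Rightarrow> ('b \<Rightarrow> 'a) \<Rightarrow> bool" where
  "unique_path_lifting Y f \<longleftrightarrow>
     (\<forall>\<alpha> \<beta>. pathin Y \<alpha> \<and> pathin Y \<beta> \<and> \<alpha> 0 = \<beta> 0 \<and> (\<forall>t\<in>{0..1}. f (\<alpha> t) = f (\<beta> t))
        \<longrightarrow> (\<forall>t\<in>{0..1}. \<alpha> t = \<beta> t))"

definition test_closed ::
    "'b::topological_space set \<Rightarrow> 'b \<Rightarrow> (real \<Rightarrow> 'b) set set \<Rightarrow> (real \<Rightarrow> 'b) set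
     \<Rightarrow> 'a::topological_space set \<Rightarrow> 'a \<Rightarrow> (real \<Rightarrow> 'a) set set \<Rightarrow> bool" where
  "test_closed S s\<^sub>0 T g X x\<^sub>0 H \<longleftrightarrow>
     subgroup H (fundamental_group X x\<^sub>0) \<and>
     (\<forall>f. continuous_on S f \<and> f ` S \<subseteq> X \<and> f s\<^sub>0 = x\<^sub>0 \<and> induced_hom X f ` T \<subseteq> H
        \<longrightarrow> induced_hom X f g \<in> H)"

definition test_closure ::
    "'b::topological_space set \<Rightarrow> 'b \<Rightarrow> (real \<Rightarrow> 'b) set set \<Rightarrow> (real \<Rightarrow> 'b) set
     \<Rightarrow> 'a::topological_space set \<Rightarrow> 'a \<Rightarrow> (real \<Rightarrow> 'a) set set \<Rightarrow> (real \<Rightarrow> 'a) set set" where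
  "test_closure S s\<^sub>0 T g X x\<^sub>0 H = \<Inter>{K. test_closed S s\<^sub>0 T g X x\<^sub>0 K \<and> H \<subseteq> K}"

definition earring :: "(real \<times> real) set" where
  "earring = (\<Union>n\<in>{1..}. sphere (1 / real n, 0) (1 / real n))"

definition earring_plus :: "(real \<times> real) set" where
  "earring_plus = earring \<union> {-1..0} \<times> {0}"

definition earring_loop :: "nat \<Rightarrow> real \<Rightarrow> real \<times> real" where
  "earring_loop n t =
     (1 / real n + cos (pi + 2 * pi * t) / real n, sin (pi + 2 * pi * t) / real n)"

text \<open>For \<open>t < 1\<close> the \<open>n \<ge> 1\<close> with \<open>(n - 1) / n \<le> t < n / (n + 1)\<close> is the integer part of
  \<open>1 / (1 - t)\<close>; that interval has length \<open>1 / (n * (n + 1))\<close>.\<close>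

definition earring_loop_inf :: "real \<Rightarrow> real \<times> real" where
  "earring_loop_inf t =
     (if t < 1
      then let n = nat \<lfloor>1 / (1 - t)\<rfloor>
           in earring_loop n ((t - (real n - 1) / real n) * (real n * (real n + 1)))
      else (0, 0))"

definition whisker :: "real \<Rightarrow> real \<times> real" where
  "whisker t = (t - 1, 0)"

definition earring_class :: "nat \<Rightarrow> (real \<Rightarrow> real \<times> real) set" where
  "earring_class n =
     path_class earring_plus (whisker +++ earring_loop n +++ reversepath whisker)"

definition earring_class_inf :: "(real \<Rightarrow> real \<times> real) set" where
  "earring_class_inf =
     path_class earring_plus (whisker +++ earring_loop_inf +++ reversepath whisker)"

definition earring_subgroup :: "(real \<Rightarrow> real \<times> real) set set" where
  "earring_subgroup =
     generate (fundamental_group earring_plus (-1, 0)) (earring_class ` {1..})"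

end

theory Submission
  imports Defs "HOL-Algebra.Zassenhaus"
begin

text \<open>
  Write \<open>H[\<alpha>]\<close> for the class of a path \<open>\<alpha>\<close> starting at \<open>x\<^sub>0\<close>.  Classes of paths
  are multiplied in the fundamental groupoid, where every identity needed below is a cancellation in
  a word of path classes.

  Unique path lifting forces the homotopically Hausdorff property for every subgroup \<open>H\<close>.  If the
  property fails at \<open>\<alpha>\<close> and \<open>g\<close>, then \<open>H[\<alpha>]\<close> and \<open>H[\<alpha> g]\<close> are distinct points of
  one fibre with the same open neighborhoods, and the path that jumps from one to the other at its
  last moment is continuous and projects to a constant path
  (\<open>homotopically_Hausdorff_rel_if_unique_path_lifting\<close>).

  For the converse, let two paths in the space of classes have the same projection \<open>f\<close> and the
  same start.  Near a time at which \<open>f\<close> is outside the wild set, the continuations of the two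
  paths differ by loops that are trivial in \<open>X\<close>, so whether they agree does not change there.  Around a time at which \<open>f\<close>
  is at a wild point \<open>w\<close>, discreteness gives an interval on which \<open>f\<close> meets no wild point but
  \<open>w\<close>.  For a neighborhood \<open>U\<close> of \<open>w\<close> let \<open>L\<close> be the product of \<open>N\<close> with
  the image of the loops in \<open>U\<close> at \<open>w\<close>.  As \<open>N\<close> contains all commutators, \<open>L\<close> is a
  normal subgroup, and it swallows the loops in \<open>U\<close> no matter along which path they are brought
  to \<open>x\<^sub>0\<close>.  Hence agreement modulo \<open>L\<close> is locally constant on the whole interval, also at
  the possibly infinitely many visits of \<open>f\<close> to \<open>w\<close>, and so is constant by connectedness.
  If the paths agree at one time of the interval, they therefore agree modulo every such \<open>L\<close> at all
  of its times, and the homotopically Hausdorff property, which says that \<open>N\<close> is the intersection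
  of these \<open>L\<close>, gives agreement modulo \<open>N\<close>
  (\<open>unique_path_lifting_if_homotopically_Hausdorff_rel\<close>).

  A subgroup \<open>K\<close> that is closed with respect to the earring test pair always has the homotopically
  Hausdorff property in a metric space (\<open>homotopically_Hausdorff_rel_if_test_closed\<close>).  If the
  coset of \<open>g\<close> contains loops \<open>\<delta> n\<close> shrinking to a point, then each \<open>\<delta> n\<close> followed by the
  reverse of \<open>\<delta> (Suc n)\<close> lies in \<open>K\<close> after transport to \<open>x\<^sub>0\<close>, so closedness puts their
  infinite product into \<open>K\<close>.  This product telescopes to \<open>\<delta> 1\<close>, whence \<open>g\<close> belongs to
  the trivial coset.  Applied to the closure of \<open>N\<close>, which again contains all commutators, this
  yields the last assertion.
\<close>

section \<open>The fundamental groupoid on path classes\<close>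

lemma paths_between_iff [simp]:
  "p \<in> paths_between X x y \<longleftrightarrow>
     path p \<and> path_image p \<subseteq> X \<and> pathstart p = x \<and> pathfinish p = y"
  by (simp add: paths_between_def)

lemma path_class_self: "path p \<Longrightarrow> path_image p \<subseteq> X \<Longrightarrow> p \<in> path_class X p"
  by (simp add: path_class_def)

lemma path_class_eq: "homotopic_paths X p q \<Longrightarrow> path_class X p = path_class X q"
  unfolding path_class_def by (blast intro: homotopic_paths_sym homotopic_paths_trans)

lemma path_class_nonempty: "q \<in> path_class X p \<Longrightarrow> path p \<and> path_image p \<subseteq> X"
  unfolding path_class_def using homotopic_paths_imp_path homotopic_paths_imp_subset by blast

lemma path_class_join:
  assumes "pathfinish p = pathstart q"
  shows "path_class X (p +++ q) = class_mult X (path_class X p) (path_class X q)"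
proof (intro subset_antisym subsetI)
  fix r assume r: "r \<in> path_class X (p +++ q)"
  then have "path (p +++ q)" "path_image (p +++ q) \<subseteq> X"
    using path_class_nonempty by blast+
  then have "path p" "path q" "path_image p \<subseteq> X" "path_image q \<subseteq> X"
    using assms by (auto simp: path_image_join)
  then have "p \<in> path_class X p" "q \<in> {q \<in> path_class X q. pathstart q = pathfinish p}"
    using path_class_self assms by auto
  then show "r \<in> class_mult X (path_class X p) (path_class X q)"
    unfolding class_mult_def using r by blast
next
  fix r assume "r \<in> class_mult X (path_class X p) (path_class X q)"
  then obtain p' q' where h: "homotopic_paths X p p'" "homotopic_paths X q q'"
      "homotopic_paths X (p' +++ q') r"
    unfolding class_mult_def path_class_def by auto
  then have "homotopic_paths X (p +++ q) (p' +++ q')"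
    using assms by (intro homotopic_paths_join)
  then show "r \<in> path_class X (p +++ q)"
    unfolding path_class_def using h(3) homotopic_paths_trans by blast
qed

lemma class_mult_iff:
  "r \<in> class_mult X c d \<longleftrightarrow>
     (\<exists>p\<in>c. \<exists>q\<in>d. pathstart q = pathfinish p \<and> homotopic_paths X (p +++ q) r)"
  by (simp add: class_mult_def path_class_def Bex_def conj_assoc)

lemma homotopic_join_parts:
  "pathfinish p = pathstart q \<Longrightarrow> homotopic_paths X (p +++ q) r \<Longrightarrow>
     path p \<and> path q \<and> path_image p \<subseteq> X \<and> path_image q \<subseteq> X"
  using homotopic_paths_imp_path[of X "p +++ q" r] homotopic_paths_imp_subset[of X "p +++ q" r]
  by (simp add: path_image_join)

text \<open>Associativity holds for arbitrary sets of paths, without any composability condition, since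
  \<^const>\<open>class_mult\<close> ignores pairs that do not compose.  Rewriting words of path classes into
  right-associated form is therefore unconditional.\<close>

lemma class_mult_assoc:
  "class_mult X (class_mult X a b) c = class_mult X a (class_mult X b c)"
proof (intro subset_antisym subsetI)
  fix r assume "r \<in> class_mult X (class_mult X a b) c"
  then obtain s p q t where h: "p \<in> a" "q \<in> b" "t \<in> c" "pathfinish p = pathstart q"
      "homotopic_paths X (p +++ q) s" "pathfinish s = pathstart t" "homotopic_paths X (s +++ t) r"
    unfolding class_mult_iff Bex_def by metis
  have 1: "pathfinish q = pathstart t"
    using homotopic_paths_imp_pathfinish[OF h(5)] h(6) by simp
  have parts: "path p" "path q" "path t" "path_image p \<subseteq> X" "path_image q \<subseteq> X" "path_image t \<subseteq> X"
    using homotopic_join_parts[OF h(4,5)] homotopic_join_parts[OF h(6,7)] by auto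
  have "homotopic_paths X ((p +++ q) +++ t) (s +++ t)"
    using h 1 parts by (intro homotopic_paths_join) auto
  then have "homotopic_paths X (p +++ (q +++ t)) r"
    using homotopic_paths_assoc[of p X q t] parts 1 h(4,7) homotopic_paths_trans by blast
  moreover have "q +++ t \<in> class_mult X b c"
    unfolding class_mult_iff using h 1 parts
    by (metis homotopic_paths_refl path_join_imp subset_path_image_join)
  ultimately show "r \<in> class_mult X a (class_mult X b c)"
    unfolding class_mult_iff[of _ _ a] using h by (metis pathstart_join)
next
  fix r assume "r \<in> class_mult X a (class_mult X b c)"
  then obtain s p q t where h: "p \<in> a" "q \<in> b" "t \<in> c" "pathfinish q = pathstart t"
      "homotopic_paths X (q +++ t) s" "pathfinish p = pathstart s" "homotopic_paths X (p +++ s) r"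
    unfolding class_mult_iff Bex_def by metis
  have 1: "pathfinish p = pathstart q"
    using homotopic_paths_imp_pathstart[OF h(5)] h(6) by simp
  have parts: "path p" "path q" "path t" "path_image p \<subseteq> X" "path_image q \<subseteq> X" "path_image t \<subseteq> X"
    using homotopic_join_parts[OF h(4,5)] homotopic_join_parts[OF h(6,7)] by auto
  have "homotopic_paths X (p +++ (q +++ t)) (p +++ s)"
    using h 1 parts by (intro homotopic_paths_join) auto
  then have "homotopic_paths X ((p +++ q) +++ t) r"
    using homotopic_paths_assoc[of p X q t] parts 1 h(4,7)
    by (meson homotopic_paths_sym homotopic_paths_trans)
  moreover have "p +++ q \<in> class_mult X a b"
    unfolding class_mult_iff using h 1 parts
    by (metis homotopic_paths_refl path_join_imp subset_path_image_join)
  ultimately show "r \<in> class_mult X (class_mult X a b) c"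
    unfolding class_mult_iff[of _ _ "class_mult X a b"] using h by (metis pathfinish_join)
qed

text \<open>An interval is convex, so two paths in it with common endpoints are homotopic; composing with
  a path \<open>p\<close> yields every reparametrization and backtracking homotopy of \<open>p\<close>.\<close>

lemma homotopic_paths_compose_interval:
  assumes "path p" "path_image p \<subseteq> X"
    and "path \<phi>" "path \<psi>" "path_image \<phi> \<subseteq> {0..1}" "path_image \<psi> \<subseteq> {0..1}"
    and "pathstart \<phi> = pathstart \<psi>" "pathfinish \<phi> = pathfinish \<psi>"
  shows "homotopic_paths X (p \<circ> \<phi>) (p \<circ> \<psi>)"
proof (rule homotopic_paths_continuous_image)
  show "homotopic_paths {0..1} \<phi> \<psi>"
  proof (rule homotopic_paths_linear)
    fix t :: real assume "t \<in> {0..1}"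
    then have "\<phi> t \<in> {0..1}" "\<psi> t \<in> {0..1}"
      using assms(5,6) unfolding path_image_def by blast+
    then show "closed_segment (\<phi> t) (\<psi> t) \<subseteq> {0..1}"
      by (intro closed_segment_subset convex_real_interval)
  qed (use assms in auto)
  show "continuous_on {0..1} p" using assms(1) by (simp add: path_def)
  show "p \<in> {0..1} \<rightarrow> X" using assms(2) by (auto simp: path_image_def)
qed

lemma path_class_const_left:
  assumes "pathstart p = x"
  shows "class_mult X (path_class X (\<lambda>_. x)) (path_class X p) = path_class X p"
proof -
  have "pathfinish (\<lambda>_. x) = pathstart p" using assms by (simp add: pathfinish_def)
  note join = path_class_join[OF this]
  show ?thesis
  proof (cases "path p \<and> path_image p \<subseteq> X")
    case True
    have "homotopic_paths X (p \<circ> ((\<lambda>_. 0) +++ id)) (p \<circ> id)"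
      using True by (intro homotopic_paths_compose_interval path_join_imp subset_path_image_join)
        (auto simp: path_def pathstart_def pathfinish_def path_image_def joinpaths_def)
    moreover have "p \<circ> ((\<lambda>_. 0) +++ id) = (\<lambda>_. x) +++ p"
      using assms by (auto simp: joinpaths_def pathstart_def)
    ultimately show ?thesis unfolding join[symmetric] by (intro path_class_eq) simp
  next
    case False
    then have "path_class X p = {}" using path_class_nonempty by blast
    then show ?thesis by (simp add: class_mult_def)
  qed
qed

lemma path_class_const_right:
  assumes "pathfinish p = x"
  shows "class_mult X (path_class X p) (path_class X (\<lambda>_. x)) = path_class X p"
proof -
  have "pathfinish p = pathstart (\<lambda>_. x)" using assms by (simp add: pathstart_def)
  note join = path_class_join[OF this]
  show ?thesis
  proof (cases "path p \<and> path_image p \<subseteq> X")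
    case True
    have "homotopic_paths X (p \<circ> (id +++ (\<lambda>_. 1))) (p \<circ> id)"
      using True by (intro homotopic_paths_compose_interval path_join_imp subset_path_image_join)
        (auto simp: path_def pathstart_def pathfinish_def path_image_def joinpaths_def)
    moreover have "p \<circ> (id +++ (\<lambda>_. 1)) = p +++ (\<lambda>_. x)"
      using assms by (auto simp: joinpaths_def pathfinish_def)
    ultimately show ?thesis unfolding join[symmetric] by (intro path_class_eq) simp
  next
    case False
    then have "path_class X p = {}" using path_class_nonempty by blast
    then show ?thesis by (simp add: class_mult_def)
  qed
qed

lemma path_class_inv_right:
  assumes "path p" "path_image p \<subseteq> X"
  shows "class_mult X (path_class X p) (path_class X (reversepath p)) = path_class X (\<lambda>_. pathstart p)"
proof -
  have "homotopic_paths X (p \<circ> (id +++ reversepath id)) (p \<circ> (\<lambda>_. 0))"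
    using assms by (intro homotopic_paths_compose_interval path_join_imp subset_path_image_join)
      (auto simp: path_def pathstart_def pathfinish_def path_image_def joinpaths_def reversepath_def
          intro!: continuous_intros)
  moreover have "p \<circ> (id +++ reversepath id) = p +++ reversepath p"
    by (auto simp: joinpaths_def reversepath_def)
  moreover have "p \<circ> (\<lambda>_::real. 0) = (\<lambda>_. pathstart p)" by (auto simp: pathstart_def)
  ultimately have "homotopic_paths X (p +++ reversepath p) (\<lambda>_. pathstart p)" by metis
  then show ?thesis by (simp flip: path_class_join add: path_class_eq)
qed

lemma path_class_inv_left:
  assumes "path p" "path_image p \<subseteq> X"
  shows "class_mult X (path_class X (reversepath p)) (path_class X p) = path_class X (\<lambda>_. pathfinish p)"
  using path_class_inv_right[of "reversepath p" X] assms by simp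

text \<open>The variants with a trailing factor let the simplifier cancel inside right-associated words.\<close>

lemma path_class_cancel:
  assumes "path p" "path_image p \<subseteq> X"
  shows "pathstart q = pathstart p \<Longrightarrow>
      class_mult X (path_class X p) (class_mult X (path_class X (reversepath p)) (path_class X q))
        = path_class X q"
    and "pathstart q = pathstart p \<Longrightarrow>
      class_mult X (path_class X p)
        (class_mult X (path_class X (reversepath p)) (class_mult X (path_class X q) c))
        = class_mult X (path_class X q) c"
    and "pathstart q = pathfinish p \<Longrightarrow>
      class_mult X (path_class X (reversepath p)) (class_mult X (path_class X p) (path_class X q))
        = path_class X q"
    and "pathstart q = pathfinish p \<Longrightarrow>
      class_mult X (path_class X (reversepath p))
        (class_mult X (path_class X p) (class_mult X (path_class X q) c))
        = class_mult X (path_class X q) c"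
proof -
  show
    "pathstart q = pathstart p \<Longrightarrow>
      class_mult X (path_class X p) (class_mult X (path_class X (reversepath p)) (path_class X q))
        = path_class X q"
    and "pathstart q = pathfinish p \<Longrightarrow>
      class_mult X (path_class X (reversepath p)) (class_mult X (path_class X p) (path_class X q))
        = path_class X q"
    by (simp_all only: class_mult_assoc[symmetric] path_class_inv_left[OF assms]
        path_class_inv_right[OF assms] path_class_const_left)
  show
    "pathstart q = pathstart p \<Longrightarrow>
      class_mult X (path_class X p)
        (class_mult X (path_class X (reversepath p)) (class_mult X (path_class X q) c))
        = class_mult X (path_class X q) c"
    and "pathstart q = pathfinish p \<Longrightarrow>
      class_mult X (path_class X (reversepath p))
        (class_mult X (path_class X p) (class_mult X (path_class X q) c))
        = class_mult X (path_class X q) c"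
    by (simp_all only: class_mult_assoc[symmetric] path_class_inv_left[OF assms]
        path_class_inv_right[OF assms] path_class_const_left)
qed

lemma path_class_const_left':
  "pathstart p = x \<Longrightarrow>
     class_mult X (path_class X (\<lambda>_. x)) (class_mult X (path_class X p) c)
       = class_mult X (path_class X p) c"
  by (simp only: class_mult_assoc[symmetric] path_class_const_left)

text \<open>This rule set decides equality of words of path classes: joins become products, products are
  associated to the right, and neighboring inverse pairs cancel.\<close>

lemmas groupoid_simps = path_class_join class_mult_assoc path_class_const_left path_class_const_left'
  path_class_const_right path_class_inv_left path_class_inv_right path_class_cancel reversepath_joinpaths
  path_image_join

lemma carrier_fundamental_group [simp]:
  "carrier (fundamental_group X x) = path_class X ` paths_between X x x"
  and mult_fundamental_group [simp]: "mult (fundamental_group X x) = class_mult X"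
  and one_fundamental_group [simp]: "one (fundamental_group X x) = path_class X (\<lambda>_. x)"
  by (simp_all add: fundamental_group_def)

lemma path_class_in_carrier:
  "p \<in> paths_between X x x \<Longrightarrow> path_class X p \<in> carrier (fundamental_group X x)"
  by auto

lemma group_fundamental_group:
  assumes "x \<in> X"
  shows "group (fundamental_group X x)"
proof (rule groupI)
  fix a b assume "a \<in> carrier (fundamental_group X x)" "b \<in> carrier (fundamental_group X x)"
  then obtain p q where "p \<in> paths_between X x x" "q \<in> paths_between X x x"
      "a = path_class X p" "b = path_class X q" by auto
  then show "a \<otimes>\<^bsub>fundamental_group X x\<^esub> b \<in> carrier (fundamental_group X x)"
    by (auto simp flip: path_class_join simp: path_image_join intro!: imageI)
next
  show "\<one>\<^bsub>fundamental_group X x\<^esub> \<in> carrier (fundamental_group X x)"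
    using assms by (auto intro!: imageI simp: path_image_def pathstart_def pathfinish_def path_def)
next
  fix a assume "a \<in> carrier (fundamental_group X x)"
  then obtain p where p: "p \<in> paths_between X x x" "a = path_class X p" by auto
  then show "\<one>\<^bsub>fundamental_group X x\<^esub> \<otimes>\<^bsub>fundamental_group X x\<^esub> a = a"
    by (simp add: groupoid_simps)
  have "path_class X (reversepath p) \<in> carrier (fundamental_group X x)"
    using p by auto
  moreover have "path_class X (reversepath p) \<otimes>\<^bsub>fundamental_group X x\<^esub> a = \<one>\<^bsub>fundamental_group X x\<^esub>"
    using p by (simp add: groupoid_simps)
  ultimately show "\<exists>y\<in>carrier (fundamental_group X x). y \<otimes>\<^bsub>fundamental_group X x\<^esub> a = \<one>\<^bsub>fundamental_group X x\<^esub>"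
    by blast
qed (simp add: class_mult_assoc)

lemma inv_fundamental_group:
  assumes "p \<in> paths_between X x x"
  shows "inv\<^bsub>fundamental_group X x\<^esub> path_class X p = path_class X (reversepath p)"
proof -
  have "x \<in> X" using assms by (auto simp: pathstart_in_path_image)
  interpret group "fundamental_group X x" by (rule group_fundamental_group) fact
  show ?thesis
  proof (rule inv_equality)
    show "path_class X (reversepath p) \<otimes>\<^bsub>fundamental_group X x\<^esub> path_class X p = \<one>\<^bsub>fundamental_group X x\<^esub>"
      using assms by (simp add: groupoid_simps)
  qed (use assms in auto)
qed

lemma subgroup_class_of_loop:
  assumes "subgroup H (fundamental_group X x)" "h \<in> H"
  obtains p where "p \<in> paths_between X x x" "h = path_class X p"
  using subgroup.mem_carrier[OF assms] by auto

section \<open>Classes of paths modulo a subgroup\<close>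

lemma lift_class_self:
  assumes "subgroup H (fundamental_group X x\<^sub>0)" "\<alpha> \<in> paths_between X x\<^sub>0 y"
  shows "\<alpha> \<in> lift_class X x\<^sub>0 H \<alpha>"
  using assms subgroup.one_closed[OF assms(1)]
  by (simp add: lift_class_def groupoid_simps)

text \<open>For fixed endpoints these are symmetry and transitivity of the relation whose classes are the
  points of the space \<open>lift_space X x\<^sub>0 H\<close>.\<close>

lemma class_quotient_closed:
  assumes "subgroup H (fundamental_group X x\<^sub>0)"
    and "\<alpha> \<in> paths_between X x\<^sub>0 y" "\<beta> \<in> paths_between X x\<^sub>0 y" "\<gamma> \<in> paths_between X x\<^sub>0 y"
  shows class_quotient_sym:
      "path_class X (\<alpha> +++ reversepath \<beta>) \<in> H \<Longrightarrow> path_class X (\<beta> +++ reversepath \<alpha>) \<in> H"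
    and class_quotient_trans:
      "path_class X (\<alpha> +++ reversepath \<beta>) \<in> H \<Longrightarrow> path_class X (\<beta> +++ reversepath \<gamma>) \<in> H \<Longrightarrow>
         path_class X (\<alpha> +++ reversepath \<gamma>) \<in> H"
proof -
  assume h: "path_class X (\<alpha> +++ reversepath \<beta>) \<in> H"
  have loop: "\<alpha> +++ reversepath \<beta> \<in> paths_between X x\<^sub>0 x\<^sub>0"
    using assms by (simp add: path_image_join)
  show "path_class X (\<beta> +++ reversepath \<alpha>) \<in> H"
    using subgroup.m_inv_closed[OF assms(1) h] assms
    unfolding inv_fundamental_group[OF loop] by (simp add: reversepath_joinpaths)
  assume k: "path_class X (\<beta> +++ reversepath \<gamma>) \<in> H"
  show "path_class X (\<alpha> +++ reversepath \<gamma>) \<in> H"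
    using subgroup.m_closed[OF assms(1) h k] assms by (simp add: groupoid_simps)
qed

lemma lift_class_eq_iff:
  assumes H: "subgroup H (fundamental_group X x\<^sub>0)"
    and ab: "\<alpha> \<in> paths_between X x\<^sub>0 y" "\<beta> \<in> paths_between X x\<^sub>0 y"
  shows "lift_class X x\<^sub>0 H \<alpha> = lift_class X x\<^sub>0 H \<beta> \<longleftrightarrow> path_class X (\<alpha> +++ reversepath \<beta>) \<in> H"
proof
  assume "lift_class X x\<^sub>0 H \<alpha> = lift_class X x\<^sub>0 H \<beta>"
  then show "path_class X (\<alpha> +++ reversepath \<beta>) \<in> H"
    using lift_class_self[OF H ab(2)] by (auto simp: lift_class_def)
next
  assume h: "path_class X (\<alpha> +++ reversepath \<beta>) \<in> H"
  have "path_class X (\<alpha> +++ reversepath \<gamma>) \<in> H \<longleftrightarrow> path_class X (\<beta> +++ reversepath \<gamma>) \<in> H"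
    if "\<gamma> \<in> paths_between X x\<^sub>0 y" for \<gamma>
    using class_quotient_sym[OF H ab that h] class_quotient_trans[OF H _ _ that] h ab by blast
  then show "lift_class X x\<^sub>0 H \<alpha> = lift_class X x\<^sub>0 H \<beta>"
    using ab unfolding lift_class_def by auto
qed

lemma lift_class_endpoint:
  assumes "subgroup H (fundamental_group X x\<^sub>0)" "\<alpha> \<in> paths_between X x\<^sub>0 y"
    and "lift_class X x\<^sub>0 H \<alpha> = lift_class X x\<^sub>0 H \<beta>"
  shows "pathfinish \<beta> = y"
proof -
  have "\<alpha> \<in> lift_class X x\<^sub>0 H \<beta>" using lift_class_self[OF assms(1,2)] assms(3) by simp
  then show ?thesis using assms(2) unfolding lift_class_def by simp
qed

lemma lift_class_append:
  assumes H: "subgroup H (fundamental_group X x\<^sub>0)"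
    and ab: "\<alpha> \<in> paths_between X x\<^sub>0 y" "\<beta> \<in> paths_between X x\<^sub>0 y" "\<epsilon> \<in> paths_between X y z"
    and eq: "lift_class X x\<^sub>0 H \<alpha> = lift_class X x\<^sub>0 H \<beta>"
  shows "lift_class X x\<^sub>0 H (\<alpha> +++ \<epsilon>) = lift_class X x\<^sub>0 H (\<beta> +++ \<epsilon>)"
proof -
  have "path_class X ((\<alpha> +++ \<epsilon>) +++ reversepath (\<beta> +++ \<epsilon>)) = path_class X (\<alpha> +++ reversepath \<beta>)"
    using ab by (simp add: groupoid_simps)
  moreover have "\<alpha> +++ \<epsilon> \<in> paths_between X x\<^sub>0 z" "\<beta> +++ \<epsilon> \<in> paths_between X x\<^sub>0 z"
    using ab by (auto simp: path_image_join)
  ultimately show ?thesis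
    using lift_class_eq_iff[OF H ab(1,2)] lift_class_eq_iff[OF H, of "\<alpha> +++ \<epsilon>" z "\<beta> +++ \<epsilon>"] eq
    by simp
qed

lemma lift_class_homotopic:
  assumes H: "subgroup H (fundamental_group X x\<^sub>0)"
    and ab: "\<alpha> \<in> paths_between X x\<^sub>0 y" "\<beta> \<in> paths_between X x\<^sub>0 y"
    and eq: "path_class X \<alpha> = path_class X \<beta>"
  shows "lift_class X x\<^sub>0 H \<alpha> = lift_class X x\<^sub>0 H \<beta>"
proof -
  have "path_class X (\<alpha> +++ reversepath \<beta>) = \<one>\<^bsub>fundamental_group X x\<^sub>0\<^esub>"
    using ab eq by (simp add: groupoid_simps)
  then show ?thesis
    using lift_class_eq_iff[OF H ab] subgroup.one_closed[OF H] by simp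
qed

lemma endpoint_proj_lift_class:
  assumes "subgroup H (fundamental_group X x\<^sub>0)" "\<alpha> \<in> paths_between X x\<^sub>0 y"
  shows "endpoint_proj (lift_class X x\<^sub>0 H \<alpha>) = y"
proof -
  have "(SOME \<beta>. \<beta> \<in> lift_class X x\<^sub>0 H \<alpha>) \<in> lift_class X x\<^sub>0 H \<alpha>"
    unfolding some_in_eq using lift_class_self[OF assms] by blast
  then show ?thesis using assms(2) unfolding endpoint_proj_def lift_class_def by simp
qed

section \<open>The homotopically Hausdorff property\<close>

lemma path_conjugate_iff:
  assumes H: "subgroup H (fundamental_group X x\<^sub>0)"
    and a: "\<alpha> \<in> paths_between X x\<^sub>0 x" and g: "\<gamma> \<in> paths_between X x x"
  shows "path_class X \<gamma> \<in> path_conjugate X H \<alpha> \<longleftrightarrow> path_class X (\<alpha> +++ \<gamma> +++ reversepath \<alpha>) \<in> H"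
proof
  assume "path_class X \<gamma> \<in> path_conjugate X H \<alpha>"
  then obtain h where h: "h \<in> H" "path_class X \<gamma> =
      class_mult X (class_mult X (path_class X (reversepath \<alpha>)) h) (path_class X \<alpha>)"
    unfolding path_conjugate_def by auto
  obtain p where "p \<in> paths_between X x\<^sub>0 x\<^sub>0" "h = path_class X p"
    using subgroup_class_of_loop[OF H h(1)] .
  then show "path_class X (\<alpha> +++ \<gamma> +++ reversepath \<alpha>) \<in> H"
    using h a g by (simp add: groupoid_simps)
next
  assume h: "path_class X (\<alpha> +++ \<gamma> +++ reversepath \<alpha>) \<in> H"
  have "path_class X \<gamma> = class_mult X (class_mult X (path_class X (reversepath \<alpha>))
      (path_class X (\<alpha> +++ \<gamma> +++ reversepath \<alpha>))) (path_class X \<alpha>)"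
    using a g by (simp add: groupoid_simps)
  then show "path_class X \<gamma> \<in> path_conjugate X H \<alpha>"
    unfolding path_conjugate_def using h by blast
qed

lemma subgroup_path_conjugate:
  assumes H: "subgroup H (fundamental_group X x\<^sub>0)" and a: "\<alpha> \<in> paths_between X x\<^sub>0 x"
  shows "subgroup (path_conjugate X H \<alpha>) (fundamental_group X x)"
proof -
  have "x \<in> X" using a by (auto simp: pathfinish_in_path_image)
  interpret group "fundamental_group X x" by (rule group_fundamental_group) fact
  have sub: "path_conjugate X H \<alpha> \<subseteq> carrier (fundamental_group X x)"
  proof
    fix c assume "c \<in> path_conjugate X H \<alpha>"
    then obtain h where h: "h \<in> H" "c =
        class_mult X (class_mult X (path_class X (reversepath \<alpha>)) h) (path_class X \<alpha>)"
      unfolding path_conjugate_def by auto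
    obtain p where p: "p \<in> paths_between X x\<^sub>0 x\<^sub>0" "h = path_class X p"
      using subgroup_class_of_loop[OF H h(1)] .
    then have "c = path_class X (reversepath \<alpha> +++ p +++ \<alpha>)"
      using h a by (simp add: groupoid_simps)
    moreover have "reversepath \<alpha> +++ p +++ \<alpha> \<in> paths_between X x x"
      using p a by (simp add: path_image_join)
    ultimately show "c \<in> carrier (fundamental_group X x)" by simp
  qed
  show ?thesis
  proof (rule subgroupI[OF sub])
    have "path_class X (\<lambda>_. x\<^sub>0) \<in> H" using subgroup.one_closed[OF H] by simp
    then show "path_conjugate X H \<alpha> \<noteq> {}" unfolding path_conjugate_def by auto
  next
    fix c assume c: "c \<in> path_conjugate X H \<alpha>"
    then obtain p where p: "p \<in> paths_between X x x" "c = path_class X p" using sub by auto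
    have l: "\<alpha> +++ p +++ reversepath \<alpha> \<in> paths_between X x\<^sub>0 x\<^sub>0"
      using p a by (simp add: path_image_join)
    have "path_class X (\<alpha> +++ p +++ reversepath \<alpha>) \<in> H"
      using c p path_conjugate_iff[OF H a] by blast
    from subgroup.m_inv_closed[OF H this]
    have "path_class X (\<alpha> +++ reversepath p +++ reversepath \<alpha>) \<in> H"
      unfolding inv_fundamental_group[OF l] using p a by (simp add: groupoid_simps)
    then show "inv\<^bsub>fundamental_group X x\<^esub> c \<in> path_conjugate X H \<alpha>"
      using path_conjugate_iff[OF H a, of "reversepath p"] p inv_fundamental_group[OF p(1)] by simp
    fix d assume d: "d \<in> path_conjugate X H \<alpha>"
    then obtain q where q: "q \<in> paths_between X x x" "d = path_class X q" using sub by auto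
    have "path_class X (\<alpha> +++ q +++ reversepath \<alpha>) \<in> H"
      using d q path_conjugate_iff[OF H a] by blast
    from subgroup.m_closed[OF H \<open>path_class X (\<alpha> +++ p +++ reversepath \<alpha>) \<in> H\<close> this]
    have "path_class X (\<alpha> +++ (p +++ q) +++ reversepath \<alpha>) \<in> H"
      using p q a by (simp add: groupoid_simps)
    then have "path_class X (p +++ q) \<in> path_conjugate X H \<alpha>"
      using path_conjugate_iff[OF H a, of "p +++ q"] p q by (simp add: path_image_join)
    then show "c \<otimes>\<^bsub>fundamental_group X x\<^esub> d \<in> path_conjugate X H \<alpha>"
      using p q by (simp add: path_class_join)
  qed
qed

lemma (in group) rcos_eq_iff:
  assumes "subgroup H G" "x \<in> carrier G" "y \<in> carrier G"
  shows "H #> x = H #> y \<longleftrightarrow> x \<otimes> inv y \<in> H"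
  using assms subgroup.rcos_module[OF assms(1) is_group assms(3,2)] rcos_self repr_independence
  by metis

text \<open>Transporting everything to \<open>x\<^sub>0\<close> along \<open>\<alpha>\<close> turns membership in the conjugate of
  \<open>H\<close> and equality of its cosets into membership in \<open>H\<close> itself.\<close>

lemma homotopically_Hausdorff_rel_iff:
  assumes H: "subgroup H (fundamental_group X x\<^sub>0)"
  shows "homotopically_Hausdorff_rel X x\<^sub>0 H \<longleftrightarrow>
    (\<forall>x \<in> X. \<forall>\<alpha> \<in> paths_between X x\<^sub>0 x. \<forall>\<gamma> \<in> paths_between X x x.
       path_class X (\<alpha> +++ \<gamma> +++ reversepath \<alpha>) \<notin> H \<longrightarrow>
       (\<exists>U. openin (top_of_set X) U \<and> x \<in> U \<and>
         (\<forall>\<delta> \<in> paths_between U x x. path_class X (\<alpha> +++ \<gamma> +++ reversepath \<delta> +++ reversepath \<alpha>) \<notin> H)))"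
proof -
  have key: "path_conjugate X H \<alpha> #>\<^bsub>fundamental_group X x\<^esub> path_class X \<gamma>
        = path_conjugate X H \<alpha> #>\<^bsub>fundamental_group X x\<^esub> path_class X \<delta>
      \<longleftrightarrow> path_class X (\<alpha> +++ \<gamma> +++ reversepath \<delta> +++ reversepath \<alpha>) \<in> H"
    if "x \<in> X" and a: "\<alpha> \<in> paths_between X x\<^sub>0 x" and g: "\<gamma> \<in> paths_between X x x"
      and d: "\<delta> \<in> paths_between X x x" for x \<alpha> \<gamma> \<delta>
  proof -
    interpret group "fundamental_group X x" by (rule group_fundamental_group) fact
    have "path_class X (\<alpha> +++ \<gamma> +++ reversepath \<delta> +++ reversepath \<alpha>)
        = path_class X (\<alpha> +++ (\<gamma> +++ reversepath \<delta>) +++ reversepath \<alpha>)"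
      using a g d by (simp add: groupoid_simps)
    also have "\<dots> \<in> H \<longleftrightarrow> path_class X (\<gamma> +++ reversepath \<delta>) \<in> path_conjugate X H \<alpha>"
      using path_conjugate_iff[OF H a, of "\<gamma> +++ reversepath \<delta>"] g d by (simp add: path_image_join)
    also have "path_class X (\<gamma> +++ reversepath \<delta>)
        = path_class X \<gamma> \<otimes>\<^bsub>fundamental_group X x\<^esub> inv\<^bsub>fundamental_group X x\<^esub> path_class X \<delta>"
      using g d by (simp add: inv_fundamental_group path_class_join)
    also have "\<dots> \<in> path_conjugate X H \<alpha> \<longleftrightarrow>
        path_conjugate X H \<alpha> #>\<^bsub>fundamental_group X x\<^esub> path_class X \<gamma>
        = path_conjugate X H \<alpha> #>\<^bsub>fundamental_group X x\<^esub> path_class X \<delta>"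
      using rcos_eq_iff[OF subgroup_path_conjugate[OF H a]] path_class_in_carrier g d by blast
    finally show ?thesis by blast
  qed
  have U: "\<delta> \<in> paths_between X x x" if "openin (top_of_set X) U" "\<delta> \<in> paths_between U x x" for U \<delta> x
    using that openin_imp_subset by fastforce
  have carr: "(\<forall>g \<in> carrier (fundamental_group X x) - path_conjugate X H \<alpha>. P g) \<longleftrightarrow>
      (\<forall>\<gamma> \<in> paths_between X x x. path_class X (\<alpha> +++ \<gamma> +++ reversepath \<alpha>) \<notin> H \<longrightarrow> P (path_class X \<gamma>))"
    if "\<alpha> \<in> paths_between X x\<^sub>0 x" for x \<alpha> P
    using path_conjugate_iff[OF H that] by (auto simp del: paths_between_iff)
  show ?thesis
    unfolding homotopically_Hausdorff_rel_def
    apply (intro ball_cong refl)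
    apply (subst carr, assumption)
    apply (intro ball_cong refl arg_cong2[where f = "(\<longrightarrow>)"] ex_cong1 conj_cong)
    using key U by (metis (no_types, lifting))
qed

section \<open>Paths in the space of classes\<close>

lemma pathin_lift_space_representative:
  assumes f: "pathin (lift_space X x\<^sub>0 H) f" and t: "t \<in> {0..1}"
  obtains y \<alpha> where "\<alpha> \<in> paths_between X x\<^sub>0 y" "f t = lift_class X x\<^sub>0 H \<alpha>"
proof -
  have "f t \<in> topspace (lift_space X x\<^sub>0 H)"
    using continuous_map_image_subset_topspace[OF f[unfolded pathin_def]] t by auto
  then obtain \<alpha> x U where h: "\<alpha> \<in> paths_between X x\<^sub>0 x" "openin (top_of_set X) U"
      "f t \<in> lift_nbhd X x\<^sub>0 H \<alpha> U"
    unfolding lift_space_def by auto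
  then obtain \<epsilon> y where e: "\<epsilon> \<in> paths_between U (pathfinish \<alpha>) y" "f t = lift_class X x\<^sub>0 H (\<alpha> +++ \<epsilon>)"
    unfolding lift_nbhd_def by auto
  have "U \<subseteq> X" using h(2) openin_imp_subset by blast
  then have "\<alpha> +++ \<epsilon> \<in> paths_between X x\<^sub>0 y"
    using h e by (auto simp: path_image_join)
  then show ?thesis using e(2) that by blast
qed

lemma const_paths_between: "x \<in> U \<Longrightarrow> (\<lambda>_. x) \<in> paths_between U x x"
  by (auto simp: path_def pathstart_def pathfinish_def path_image_def)

lemma lift_class_append_const:
  assumes H: "subgroup H (fundamental_group X x\<^sub>0)" and a: "\<alpha> \<in> paths_between X x\<^sub>0 y"
  shows "lift_class X x\<^sub>0 H (\<alpha> +++ (\<lambda>_. y)) = lift_class X x\<^sub>0 H \<alpha>"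
proof (rule lift_class_homotopic[OF H _ a])
  have y: "y \<in> X" using a by (auto simp: pathfinish_in_path_image)
  note c = const_paths_between[OF y]
  show "\<alpha> +++ (\<lambda>_. y) \<in> paths_between X x\<^sub>0 y"
    using a c by (simp add: path_image_join)
  show "path_class X (\<alpha> +++ (\<lambda>_. y)) = path_class X \<alpha>"
    using a c by (simp add: groupoid_simps)
qed

lemma mem_lift_nbhd_iff:
  assumes "\<alpha> \<in> paths_between X x\<^sub>0 y"
  shows "c \<in> lift_nbhd X x\<^sub>0 H \<alpha> U \<longleftrightarrow>
    (\<exists>z. \<exists>\<epsilon>\<in>paths_between U y z. c = lift_class X x\<^sub>0 H (\<alpha> +++ \<epsilon>))"
proof -
  have "pathfinish \<alpha> = y" using assms by simp
  then show ?thesis unfolding lift_nbhd_def by blast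
qed

text \<open>Continuity at a time \<open>t\<close>: one representative \<open>\<alpha>\<close> of the value at \<open>t\<close> serves for
  all nearby times, up to an extension inside \<open>U\<close>.\<close>

lemma pathin_lift_space_nearby:
  assumes H: "subgroup H (fundamental_group X x\<^sub>0)"
    and f: "pathin (lift_space X x\<^sub>0 H) f" and t: "t \<in> {0..1}"
    and a: "\<alpha> \<in> paths_between X x\<^sub>0 y" "f t = lift_class X x\<^sub>0 H \<alpha>"
    and U: "openin (top_of_set X) U" "y \<in> U"
  obtains T where "openin (top_of_set {0..1}) T" "t \<in> T"
    "\<forall>s\<in>T. \<exists>z. \<exists>\<epsilon>\<in>paths_between U y z. f s = lift_class X x\<^sub>0 H (\<alpha> +++ \<epsilon>)"
proof
  let ?T = "{s \<in> {0..1}. f s \<in> lift_nbhd X x\<^sub>0 H \<alpha> U}"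
  have "openin (lift_space X x\<^sub>0 H) (lift_nbhd X x\<^sub>0 H \<alpha> U)"
    unfolding lift_space_def using a U by (intro topology_generated_by_Basis) blast
  then show "openin (top_of_set {0..1}) ?T"
    using openin_continuous_map_preimage[OF f[unfolded pathin_def]] by simp
  have c: "(\<lambda>_. y) \<in> paths_between U y y" by (rule const_paths_between) fact
  then show "t \<in> ?T"
    using t a(2) lift_class_append_const[OF H a(1)] mem_lift_nbhd_iff[OF a(1)] by blast
  show "\<forall>s\<in>?T. \<exists>z. \<exists>\<epsilon>\<in>paths_between U y z. f s = lift_class X x\<^sub>0 H (\<alpha> +++ \<epsilon>)"
    using mem_lift_nbhd_iff[OF a(1)] by blast
qed

text \<open>If \<open>X\<close> fails to be homotopically Hausdorff relative to \<open>H\<close>, then some fibre contains two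
  points with the same open neighborhoods.  Jumping from one to the other is continuous and
  projects to a constant path, so paths do not lift uniquely.\<close>

theorem homotopically_Hausdorff_rel_if_unique_path_lifting:
  assumes H: "subgroup H (fundamental_group X x\<^sub>0)"
    and upl: "unique_path_lifting (lift_space X x\<^sub>0 H) endpoint_proj"
  shows "homotopically_Hausdorff_rel X x\<^sub>0 H"
  unfolding homotopically_Hausdorff_rel_iff[OF H]
proof (intro ballI impI, rule ccontr)
  fix x \<alpha> \<gamma>
  assume x: "x \<in> X" and a: "\<alpha> \<in> paths_between X x\<^sub>0 x" and g: "\<gamma> \<in> paths_between X x x"
    and notin: "path_class X (\<alpha> +++ \<gamma> +++ reversepath \<alpha>) \<notin> H"
    and "\<nexists>U. openin (top_of_set X) U \<and> x \<in> U \<and>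
      (\<forall>\<delta>\<in>paths_between U x x. path_class X (\<alpha> +++ \<gamma> +++ reversepath \<delta> +++ reversepath \<alpha>) \<notin> H)"
  then have small: "\<exists>\<delta>\<in>paths_between U x x. path_class X (\<alpha> +++ \<gamma> +++ reversepath \<delta> +++ reversepath \<alpha>) \<in> H"
    if "openin (top_of_set X) U" "x \<in> U" for U
    using that by blast
  let ?A = "lift_class X x\<^sub>0 H \<alpha>" and ?B = "lift_class X x\<^sub>0 H (\<alpha> +++ \<gamma>)"
  have ag: "\<alpha> +++ \<gamma> \<in> paths_between X x\<^sub>0 x" using a g by (simp add: path_image_join)
  have "path_class X ((\<alpha> +++ \<gamma>) +++ reversepath \<alpha>) \<notin> H"
    using notin a g by (simp add: groupoid_simps)
  then have neq: "?A \<noteq> ?B" using lift_class_eq_iff[OF H ag a] by auto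
  have small': "\<exists>\<delta>\<in>paths_between U x x. ?B = lift_class X x\<^sub>0 H (\<alpha> +++ \<delta>)"
    if U: "openin (top_of_set X) U" "x \<in> U" for U
  proof -
    obtain \<delta> where d: "\<delta> \<in> paths_between U x x"
        "path_class X (\<alpha> +++ \<gamma> +++ reversepath \<delta> +++ reversepath \<alpha>) \<in> H"
      using small[OF U] by blast
    have UX: "U \<subseteq> X" using U openin_imp_subset by blast
    have "\<alpha> +++ \<delta> \<in> paths_between X x\<^sub>0 x" using a d(1) UX by (auto simp: path_image_join)
    moreover have "path_class X ((\<alpha> +++ \<gamma>) +++ reversepath (\<alpha> +++ \<delta>)) \<in> H"
      using d a g UX by (simp add: groupoid_simps)
    ultimately show ?thesis using lift_class_eq_iff[OF H ag] d(1) by blast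
  qed
  have same_nbhds: "?A \<in> lift_nbhd X x\<^sub>0 H \<beta> U \<longleftrightarrow> ?B \<in> lift_nbhd X x\<^sub>0 H \<beta> U"
    if b: "\<beta> \<in> paths_between X x\<^sub>0 z" and U: "openin (top_of_set X) U" for \<beta> z U
  proof
    have UX: "U \<subseteq> X" using U openin_imp_subset by blast
    assume "?A \<in> lift_nbhd X x\<^sub>0 H \<beta> U"
    then obtain \<epsilon> y where e: "\<epsilon> \<in> paths_between U z y" "?A = lift_class X x\<^sub>0 H (\<beta> +++ \<epsilon>)"
      unfolding mem_lift_nbhd_iff[OF b] by blast
    then have "y = x" using lift_class_endpoint[OF H a e(2)] by simp
    then have "x \<in> U" using e pathfinish_in_path_image by force
    then obtain \<delta> where d: "\<delta> \<in> paths_between U x x" "?B = lift_class X x\<^sub>0 H (\<alpha> +++ \<delta>)"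
      using small'[OF U] by blast
    have be: "\<beta> +++ \<epsilon> \<in> paths_between X x\<^sub>0 x"
      using b e UX \<open>y = x\<close> by (auto simp: path_image_join)
    have dX: "\<delta> \<in> paths_between X x x" using d UX by auto
    have ed: "\<epsilon> +++ \<delta> \<in> paths_between U z x" using e d \<open>y = x\<close> by (auto simp: path_image_join)
    have "?B = lift_class X x\<^sub>0 H ((\<beta> +++ \<epsilon>) +++ \<delta>)"
      unfolding d(2) by (rule lift_class_append[OF H a be dX e(2)])
    also have "\<dots> = lift_class X x\<^sub>0 H (\<beta> +++ (\<epsilon> +++ \<delta>))"
      using be dX ed b e(1) UX \<open>y = x\<close>
      by (intro lift_class_homotopic[OF H, of _ x]) (auto simp: path_image_join groupoid_simps)
    finally show "?B \<in> lift_nbhd X x\<^sub>0 H \<beta> U"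
      unfolding mem_lift_nbhd_iff[OF b] using ed by blast
  next
    have UX: "U \<subseteq> X" using U openin_imp_subset by blast
    assume "?B \<in> lift_nbhd X x\<^sub>0 H \<beta> U"
    then obtain \<epsilon> y where e: "\<epsilon> \<in> paths_between U z y" "?B = lift_class X x\<^sub>0 H (\<beta> +++ \<epsilon>)"
      unfolding mem_lift_nbhd_iff[OF b] by blast
    then have "y = x" using lift_class_endpoint[OF H ag e(2)] by simp
    then have "x \<in> U" using e pathfinish_in_path_image by force
    then obtain \<delta> where d: "\<delta> \<in> paths_between U x x" "?B = lift_class X x\<^sub>0 H (\<alpha> +++ \<delta>)"
      using small'[OF U] by blast
    have be: "\<beta> +++ \<epsilon> \<in> paths_between X x\<^sub>0 x"
      using b e UX \<open>y = x\<close> by (auto simp: path_image_join)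
    have dX: "\<delta> \<in> paths_between X x x" using d UX by auto
    have ad: "\<alpha> +++ \<delta> \<in> paths_between X x\<^sub>0 x" using a dX by (auto simp: path_image_join)
    have ed: "\<epsilon> +++ reversepath \<delta> \<in> paths_between U z x"
      using e d \<open>y = x\<close> by (auto simp: path_image_join)
    have "?A = lift_class X x\<^sub>0 H ((\<alpha> +++ \<delta>) +++ reversepath \<delta>)"
      using a dX
      by (intro lift_class_homotopic[OF H, of _ x]) (auto simp: path_image_join groupoid_simps)
    also have "\<dots> = lift_class X x\<^sub>0 H ((\<beta> +++ \<epsilon>) +++ reversepath \<delta>)"
      using dX d(2) e(2) by (intro lift_class_append[OF H ad be, of _ x]) auto
    also have "\<dots> = lift_class X x\<^sub>0 H (\<beta> +++ (\<epsilon> +++ reversepath \<delta>))"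
      using be dX ed b e(1) UX \<open>y = x\<close>
      by (intro lift_class_homotopic[OF H, of _ x]) (auto simp: path_image_join groupoid_simps)
    finally show "?A \<in> lift_nbhd X x\<^sub>0 H \<beta> U"
      unfolding mem_lift_nbhd_iff[OF b] using ed by blast
  qed
  \<comment> \<open>The two points are topologically indistinguishable, so a jump between them is continuous.\<close>
  define basis where "basis = {lift_nbhd X x\<^sub>0 H \<alpha> U | \<alpha> x U.
      \<alpha> \<in> paths_between X x\<^sub>0 x \<and> openin (top_of_set X) U \<and> x \<in> U}"
  have AB: "\<forall>S\<in>basis. ?A \<in> S \<longleftrightarrow> ?B \<in> S"
    unfolding basis_def using same_nbhds by blast
  have "?A \<in> lift_nbhd X x\<^sub>0 H \<alpha> X"
    unfolding mem_lift_nbhd_iff[OF a]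
    using lift_class_append_const[OF H a] const_paths_between[OF x] by blast
  moreover have "openin (top_of_set X) X" by simp
  then have "lift_nbhd X x\<^sub>0 H \<alpha> X \<in> basis" unfolding basis_def using a x by blast
  ultimately have AU: "?A \<in> \<Union>basis" by blast
  then have BU: "?B \<in> \<Union>basis" using AB by blast
  have path: "pathin (lift_space X x\<^sub>0 H) (\<lambda>t. if t < 1 then ?A else C)" if "C = ?A \<or> C = ?B" for C
    unfolding pathin_def lift_space_def basis_def[symmetric]
  proof (rule continuous_on_generated_topo)
    fix S assume "S \<in> basis"
    then have "C \<in> S \<longleftrightarrow> ?A \<in> S" using AB that by blast
    then have eq: "(\<lambda>t::real. if t < 1 then ?A else C) -` S = (if ?A \<in> S then UNIV else {})"
      by (auto split: if_splits)
    show "openin (top_of_set {0..1}) ((\<lambda>t::real. if t < 1 then ?A else C) -` S \<inter> topspace (top_of_set {0..1}))"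
      unfolding eq by simp
  qed (use AU BU that in auto)
  have "endpoint_proj ?A = endpoint_proj ?B"
    using endpoint_proj_lift_class[OF H a] endpoint_proj_lift_class[OF H ag] by simp
  then have "(if (1::real) < 1 then ?A else ?A) = (if (1::real) < 1 then ?A else ?B)"
    using upl[unfolded unique_path_lifting_def, rule_format,
        of "\<lambda>t. if t < 1 then ?A else ?A" "\<lambda>t. if t < 1 then ?A else ?B" 1]
      path[of ?A] path[of ?B] by simp
  then show False using neq by simp
qed

section \<open>Unique path lifting over a discrete wild set\<close>

text \<open>The quantifier ranges over all \<open>\<alpha>\<close> because a lift may approach \<open>y\<close> along any class of
  paths.\<close>

definition absorbs_loops ::
    "'a::topological_space set \<Rightarrow> 'a \<Rightarrow> (real \<Rightarrow> 'a) set set \<Rightarrow> 'a \<Rightarrow> 'a set \<Rightarrow> bool" where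
  "absorbs_loops X x\<^sub>0 L y U \<longleftrightarrow>
     (\<forall>\<alpha>\<in>paths_between X x\<^sub>0 y. \<forall>\<delta>\<in>paths_between U y y.
        path_class X (\<alpha> +++ \<delta> +++ reversepath \<alpha>) \<in> L)"

text \<open>The arguments are classes modulo a subgroup \<open>N\<close>, while agreement is tested modulo a larger
  subgroup \<open>L\<close>; the choice of representatives is then immaterial.\<close>

definition agree_modulo ::
    "'a::topological_space set \<Rightarrow> (real \<Rightarrow> 'a) set set \<Rightarrow> (real \<Rightarrow> 'a) set \<Rightarrow> (real \<Rightarrow> 'a) set \<Rightarrow> bool"
  where
  "agree_modulo X L c d \<longleftrightarrow> (\<exists>\<alpha>\<in>c. \<exists>\<beta>\<in>d. path_class X (\<alpha> +++ reversepath \<beta>) \<in> L)"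

lemma agree_modulo_lift_class_iff:
  assumes N: "subgroup N (fundamental_group X x\<^sub>0)" and L: "subgroup L (fundamental_group X x\<^sub>0)"
    and NL: "N \<subseteq> L"
    and ab: "\<alpha> \<in> paths_between X x\<^sub>0 y" "\<beta> \<in> paths_between X x\<^sub>0 y"
  shows "agree_modulo X L (lift_class X x\<^sub>0 N \<alpha>) (lift_class X x\<^sub>0 N \<beta>)
    \<longleftrightarrow> path_class X (\<alpha> +++ reversepath \<beta>) \<in> L"
proof
  assume "agree_modulo X L (lift_class X x\<^sub>0 N \<alpha>) (lift_class X x\<^sub>0 N \<beta>)"
  then obtain \<alpha>' \<beta>' where h: "\<alpha>' \<in> lift_class X x\<^sub>0 N \<alpha>" "\<beta>' \<in> lift_class X x\<^sub>0 N \<beta>"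
      "path_class X (\<alpha>' +++ reversepath \<beta>') \<in> L"
    unfolding agree_modulo_def by blast
  then have p: "\<alpha>' \<in> paths_between X x\<^sub>0 y" "\<beta>' \<in> paths_between X x\<^sub>0 y"
    using ab unfolding lift_class_def by auto
  have "path_class X (\<alpha> +++ reversepath \<alpha>') \<in> L" "path_class X (\<beta> +++ reversepath \<beta>') \<in> L"
    using h NL unfolding lift_class_def by auto
  then show "path_class X (\<alpha> +++ reversepath \<beta>) \<in> L"
    using class_quotient_trans[OF L ab(1) p(1) p(2)] class_quotient_trans[OF L ab(1) p(2) ab(2)]
      class_quotient_sym[OF L ab(2) p(2) p(2)] h(3) by blast
next
  assume "path_class X (\<alpha> +++ reversepath \<beta>) \<in> L"
  then show "agree_modulo X L (lift_class X x\<^sub>0 N \<alpha>) (lift_class X x\<^sub>0 N \<beta>)"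
    unfolding agree_modulo_def using lift_class_self[OF N] ab by blast
qed

lemma (in group) subgroup_mult_left_iff:
  assumes "subgroup H G" "h \<in> H" "g \<in> carrier G"
  shows "h \<otimes> g \<in> H \<longleftrightarrow> g \<in> H"
proof
  assume "h \<otimes> g \<in> H"
  then have "inv h \<otimes> (h \<otimes> g) \<in> H"
    using assms by (simp add: subgroup.m_closed subgroup.m_inv_closed)
  then show "g \<in> H"
    using assms subgroup.mem_carrier[OF assms(1,2)] by (simp flip: m_assoc)
qed (use assms in \<open>simp add: subgroup.m_closed\<close>)

text \<open>Near \<open>s\<close> the two lifts continue representatives \<open>\<alpha>\<close> and \<open>\<beta>\<close> by paths in
  \<open>U\<close> with a common endpoint.  One of these followed by the reverse of the other is a loop in
  \<open>U\<close>, and inserting a loop that \<open>L\<close> absorbs does not affect agreement modulo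
  \<open>L\<close>.\<close>

lemma agree_modulo_locally_constant:
  assumes N: "subgroup N (fundamental_group X x\<^sub>0)" and L: "subgroup L (fundamental_group X x\<^sub>0)"
    and NL: "N \<subseteq> L"
    and f: "pathin (lift_space X x\<^sub>0 N) f" and g: "pathin (lift_space X x\<^sub>0 N) g"
    and proj: "\<forall>t\<in>{0..1}. endpoint_proj (f t) = endpoint_proj (g t)"
    and s: "s \<in> {0..1}" and U: "openin (top_of_set X) U" "endpoint_proj (f s) \<in> U"
    and absorb: "absorbs_loops X x\<^sub>0 L (endpoint_proj (f s)) U"
  obtains T where "openin (top_of_set {0..1}) T" "s \<in> T"
    "\<forall>r\<in>T. agree_modulo X L (f r) (g r) \<longleftrightarrow> agree_modulo X L (f s) (g s)"
proof -
  obtain y \<alpha> where a: "\<alpha> \<in> paths_between X x\<^sub>0 y" "f s = lift_class X x\<^sub>0 N \<alpha>"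
    using pathin_lift_space_representative[OF f s] .
  obtain y' \<beta> where "\<beta> \<in> paths_between X x\<^sub>0 y'" "g s = lift_class X x\<^sub>0 N \<beta>"
    using pathin_lift_space_representative[OF g s] .
  moreover have y: "endpoint_proj (f s) = y" using endpoint_proj_lift_class[OF N a(1)] a(2) by simp
  ultimately have b: "\<beta> \<in> paths_between X x\<^sub>0 y" "g s = lift_class X x\<^sub>0 N \<beta>"
    using endpoint_proj_lift_class[OF N, of \<beta> y'] proj s by auto
  have yU: "y \<in> U" using U(2) y by simp
  have UX: "U \<subseteq> X" using U openin_imp_subset by blast
  have "x\<^sub>0 \<in> X" using a by (auto simp: pathstart_in_path_image)
  interpret group "fundamental_group X x\<^sub>0" by (rule group_fundamental_group) fact
  obtain T\<^sub>1 where T1: "openin (top_of_set {0..1}) T\<^sub>1" "s \<in> T\<^sub>1"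
      "\<forall>r\<in>T\<^sub>1. \<exists>z. \<exists>\<epsilon>\<in>paths_between U y z. f r = lift_class X x\<^sub>0 N (\<alpha> +++ \<epsilon>)"
    using pathin_lift_space_nearby[OF N f s a U(1) yU] .
  obtain T\<^sub>2 where T2: "openin (top_of_set {0..1}) T\<^sub>2" "s \<in> T\<^sub>2"
      "\<forall>r\<in>T\<^sub>2. \<exists>z. \<exists>\<epsilon>\<in>paths_between U y z. g r = lift_class X x\<^sub>0 N (\<beta> +++ \<epsilon>)"
    using pathin_lift_space_nearby[OF N g s b U(1) yU] .
  show ?thesis
  proof (rule that[of "T\<^sub>1 \<inter> T\<^sub>2"], rule_tac [3] ballI)
    fix r assume r: "r \<in> T\<^sub>1 \<inter> T\<^sub>2"
    obtain z \<epsilon> where e: "\<epsilon> \<in> paths_between U y z" "f r = lift_class X x\<^sub>0 N (\<alpha> +++ \<epsilon>)"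
      using T1(3) r by blast
    obtain z' \<eta> where h: "\<eta> \<in> paths_between U y z'" "g r = lift_class X x\<^sub>0 N (\<beta> +++ \<eta>)"
      using T2(3) r by blast
    have ae: "\<alpha> +++ \<epsilon> \<in> paths_between X x\<^sub>0 z" using a e UX by (auto simp: path_image_join)
    have bh': "\<beta> +++ \<eta> \<in> paths_between X x\<^sub>0 z'" using b h UX by (auto simp: path_image_join)
    have "r \<in> {0..1}" using r T1(1) openin_imp_subset by blast
    then have "z' = z"
      using endpoint_proj_lift_class[OF N ae] endpoint_proj_lift_class[OF N bh'] proj e(2) h(2) by metis
    note bh = bh'[unfolded this] and h = h[unfolded this]
    let ?\<delta> = "\<epsilon> +++ reversepath \<eta>"
    have d: "?\<delta> \<in> paths_between U y y" using e h by (simp add: path_image_join)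
    then have in_L: "path_class X (\<alpha> +++ ?\<delta> +++ reversepath \<alpha>) \<in> L"
      using absorb a(1) unfolding y absorbs_loops_def by blast
    have ab: "\<alpha> +++ reversepath \<beta> \<in> paths_between X x\<^sub>0 x\<^sub>0"
      using a b by (simp add: path_image_join)
    have "path_class X ((\<alpha> +++ \<epsilon>) +++ reversepath (\<beta> +++ \<eta>))
        = path_class X (\<alpha> +++ ?\<delta> +++ reversepath \<alpha>)
          \<otimes>\<^bsub>fundamental_group X x\<^sub>0\<^esub> path_class X (\<alpha> +++ reversepath \<beta>)"
      using a b e h UX by (simp add: groupoid_simps)
    then have "path_class X ((\<alpha> +++ \<epsilon>) +++ reversepath (\<beta> +++ \<eta>)) \<in> L
        \<longleftrightarrow> path_class X (\<alpha> +++ reversepath \<beta>) \<in> L"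
      using subgroup_mult_left_iff[OF L in_L path_class_in_carrier[OF ab]] by simp
    then show "agree_modulo X L (f r) (g r) \<longleftrightarrow> agree_modulo X L (f s) (g s)"
      unfolding e(2) h(2) a(2) b(2) agree_modulo_lift_class_iff[OF N L NL ae bh]
        agree_modulo_lift_class_iff[OF N L NL a(1) b(1)] .
  qed (use T1 T2 in auto)
qed

lemma (in group) normal_if_contains_derived:
  assumes N: "subgroup N G" and D: "derived G (carrier G) \<subseteq> N"
  shows "N \<lhd> G"
proof -
  have "x \<otimes> h \<otimes> inv x \<in> N" if x: "x \<in> carrier G" and h: "h \<in> N" for x h
  proof -
    have hc: "h \<in> carrier G" using subgroup.mem_carrier[OF N h] .
    have "x \<otimes> h \<otimes> inv x \<otimes> inv h \<in> derived G (carrier G)"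
      unfolding derived_def using x hc by (intro generate.incl) blast
    then have "x \<otimes> h \<otimes> inv x \<otimes> inv h \<otimes> h \<in> N"
      using D h N by (blast intro: subgroup.m_closed)
    then show ?thesis using x hc by (simp add: m_assoc)
  qed
  then show ?thesis using N by (simp add: normal_inv_iff)
qed

text \<open>The smallest enlargement of \<open>N\<close> that absorbs the loops in \<open>U\<close> based at \<open>w\<close>.  It
  contains the commutator subgroup, hence is normal, so it does not matter along which path from
  \<open>x\<^sub>0\<close> to \<open>w\<close> these loops are transported.\<close>

lemma adjoin_small_loops:
  assumes N: "subgroup N (fundamental_group X x\<^sub>0)"
    and D: "derived (fundamental_group X x\<^sub>0) (carrier (fundamental_group X x\<^sub>0)) \<subseteq> N"
    and \<rho>: "\<rho> \<in> paths_between X x\<^sub>0 w" and U: "U \<subseteq> X" "w \<in> U"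
  obtains L where "subgroup L (fundamental_group X x\<^sub>0)" "N \<subseteq> L" "absorbs_loops X x\<^sub>0 L w U"
    "\<forall>c\<in>L. \<exists>n\<in>N. \<exists>\<delta>\<in>paths_between U w w.
        c = class_mult X n (path_class X (\<rho> +++ \<delta> +++ reversepath \<rho>))"
proof -
  have "x\<^sub>0 \<in> X" using \<rho> by (auto simp: pathstart_in_path_image)
  interpret group "fundamental_group X x\<^sub>0" by (rule group_fundamental_group) fact
  have normal: "N \<lhd> fundamental_group X x\<^sub>0" using normal_if_contains_derived[OF N D] .
  define J where "J = (\<lambda>\<delta>. path_class X (\<rho> +++ \<delta> +++ reversepath \<rho>)) ` paths_between U w w"
  have loop: "\<rho> +++ \<delta> +++ reversepath \<rho> \<in> paths_between X x\<^sub>0 x\<^sub>0" if "\<delta> \<in> paths_between U w w" for \<delta>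
    using that \<rho> U by (auto simp: path_image_join)
  have J: "subgroup J (fundamental_group X x\<^sub>0)"
  proof (rule subgroupI)
    show "J \<subseteq> carrier (fundamental_group X x\<^sub>0)"
      unfolding J_def using loop path_class_in_carrier by blast
    show "J \<noteq> {}" unfolding J_def using const_paths_between[OF U(2)] by blast
  next
    fix a assume "a \<in> J"
    then obtain \<delta> where d: "\<delta> \<in> paths_between U w w" "a = path_class X (\<rho> +++ \<delta> +++ reversepath \<rho>)"
      unfolding J_def by blast
    have "inv\<^bsub>fundamental_group X x\<^sub>0\<^esub> a = path_class X (\<rho> +++ reversepath \<delta> +++ reversepath \<rho>)"
      unfolding d(2) inv_fundamental_group[OF loop[OF d(1)]]
      using d(1) \<rho> U by (simp add: groupoid_simps)
    moreover have "reversepath \<delta> \<in> paths_between U w w" using d(1) by simp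
    ultimately show "inv\<^bsub>fundamental_group X x\<^sub>0\<^esub> a \<in> J" unfolding J_def by blast
    fix b assume "b \<in> J"
    then obtain \<eta> where h: "\<eta> \<in> paths_between U w w" "b = path_class X (\<rho> +++ \<eta> +++ reversepath \<rho>)"
      unfolding J_def by blast
    have "\<delta> +++ \<eta> \<in> paths_between U w w" using d(1) h(1) by (simp add: path_image_join)
    moreover have "a \<otimes>\<^bsub>fundamental_group X x\<^sub>0\<^esub> b = path_class X (\<rho> +++ (\<delta> +++ \<eta>) +++ reversepath \<rho>)"
      using d h \<rho> U by (auto simp: groupoid_simps)
    ultimately show "a \<otimes>\<^bsub>fundamental_group X x\<^sub>0\<^esub> b \<in> J" unfolding J_def by blast
  qed
  define L where "L = N <#>\<^bsub>fundamental_group X x\<^sub>0\<^esub> J"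
  have L: "subgroup L (fundamental_group X x\<^sub>0)"
    unfolding L_def using mult_norm_subgroup[OF normal J] .
  have NL: "N \<subseteq> L"
  proof
    fix n assume n: "n \<in> N"
    then have "n \<otimes>\<^bsub>fundamental_group X x\<^sub>0\<^esub> \<one>\<^bsub>fundamental_group X x\<^sub>0\<^esub> \<in> L"
      unfolding L_def set_mult_def using subgroup.one_closed[OF J] by blast
    then show "n \<in> L" using r_one[OF subgroup.mem_carrier[OF N n]] by simp
  qed
  have JL: "J \<subseteq> L"
  proof
    fix j assume j: "j \<in> J"
    then have "\<one>\<^bsub>fundamental_group X x\<^sub>0\<^esub> \<otimes>\<^bsub>fundamental_group X x\<^sub>0\<^esub> j \<in> L"
      unfolding L_def set_mult_def using subgroup.one_closed[OF N] by blast
    then show "j \<in> L" using l_one[OF subgroup.mem_carrier[OF J j]] by simp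
  qed
  have Lnormal: "L \<lhd> fundamental_group X x\<^sub>0"
    using normal_if_contains_derived[OF L] D NL by blast
  have "absorbs_loops X x\<^sub>0 L w U"
    unfolding absorbs_loops_def
  proof (intro ballI)
    fix \<alpha> \<delta> assume a: "\<alpha> \<in> paths_between X x\<^sub>0 w" and d: "\<delta> \<in> paths_between U w w"
    \<comment> \<open>Transport along \<open>\<alpha>\<close> is transport along \<open>\<rho>\<close> followed by conjugation with
      the class of \<open>\<alpha> +++ reversepath \<rho>\<close>.\<close>
    have k: "\<alpha> +++ reversepath \<rho> \<in> paths_between X x\<^sub>0 x\<^sub>0"
      using a \<rho> by (simp add: path_image_join)
    have "path_class X (\<rho> +++ \<delta> +++ reversepath \<rho>) \<in> L" using JL d unfolding J_def by blast
    then have "path_class X (\<alpha> +++ reversepath \<rho>) \<otimes>\<^bsub>fundamental_group X x\<^sub>0\<^esub>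
        path_class X (\<rho> +++ \<delta> +++ reversepath \<rho>) \<otimes>\<^bsub>fundamental_group X x\<^sub>0\<^esub>
        inv\<^bsub>fundamental_group X x\<^sub>0\<^esub> path_class X (\<alpha> +++ reversepath \<rho>) \<in> L"
      using Lnormal path_class_in_carrier[OF k] unfolding normal_inv_iff by blast
    then show "path_class X (\<alpha> +++ \<delta> +++ reversepath \<alpha>) \<in> L"
      unfolding inv_fundamental_group[OF k]
      using a d \<rho> U by (auto simp: groupoid_simps)
  qed
  moreover have "\<forall>c\<in>L. \<exists>n\<in>N. \<exists>\<delta>\<in>paths_between U w w.
      c = class_mult X n (path_class X (\<rho> +++ \<delta> +++ reversepath \<rho>))"
    unfolding L_def J_def set_mult_def by auto
  ultimately show ?thesis by (rule that[OF L NL])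
qed

lemma absorbs_loops_if_semilocally_simply_connected:
  assumes N: "subgroup N (fundamental_group X x\<^sub>0)" and y: "y \<in> X" "y \<notin> wild_set X"
  obtains U where "openin (top_of_set X) U" "y \<in> U" "absorbs_loops X x\<^sub>0 N y U"
proof -
  have "semilocally_simply_connected_at X y" using y unfolding wild_set_def by blast
  then obtain U where U: "openin (top_of_set X) U" "y \<in> U"
      and triv: "\<forall>g \<in> carrier (fundamental_group U y).
        induced_hom X (\<lambda>y. y) g = \<one>\<^bsub>fundamental_group X y\<^esub>"
    unfolding semilocally_simply_connected_at_def by blast
  have UX: "U \<subseteq> X" using U openin_imp_subset by blast
  have "absorbs_loops X x\<^sub>0 N y U"
    unfolding absorbs_loops_def
  proof (intro ballI)
    fix \<alpha> \<delta> assume a: "\<alpha> \<in> paths_between X x\<^sub>0 y" and d: "\<delta> \<in> paths_between U y y"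
    have "\<delta> \<in> path_class X \<delta>" using d UX by (auto intro: path_class_self)
    moreover have "path_class X \<delta> \<subseteq> induced_hom X (\<lambda>y. y) (path_class U \<delta>)"
      using d path_class_self[of \<delta> U] by (auto simp: induced_hom_def o_def)
    moreover have "induced_hom X (\<lambda>y. y) (path_class U \<delta>) = path_class X (\<lambda>_. y)"
      using triv path_class_in_carrier[OF d] by auto
    ultimately have "\<delta> \<in> path_class X (\<lambda>_. y)" by blast
    then have "homotopic_paths X (\<lambda>_. y) \<delta>" by (simp add: path_class_def)
    then have eq: "path_class X \<delta> = path_class X (\<lambda>_. y)" by (simp add: path_class_eq)
    have "path_class X (\<alpha> +++ \<delta> +++ reversepath \<alpha>) = path_class X (\<lambda>_. x\<^sub>0)"
      using a d eq by (simp add: groupoid_simps)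
    then show "path_class X (\<alpha> +++ \<delta> +++ reversepath \<alpha>) \<in> N"
      using subgroup.one_closed[OF N] by simp
  qed
  then show ?thesis using that U by blast
qed

lemma absorbs_loops_mono: "absorbs_loops X x\<^sub>0 N y U \<Longrightarrow> N \<subseteq> L \<Longrightarrow> absorbs_loops X x\<^sub>0 L y U"
  unfolding absorbs_loops_def by blast

text \<open>Agreement of two lifts is first examined modulo the subgroup \<open>L\<close> that absorbs the loops
  in a small neighborhood \<open>U\<close> of an isolated wild point \<open>w\<close>.  On a short interval
  whose image meets the wild set in \<open>w\<close> only, every point has a neighborhood absorbed by
  \<open>L\<close>, so agreement modulo \<open>L\<close> propagates over the whole interval, however often the
  projected path returns to \<open>w\<close>.  Letting \<open>U\<close> shrink and using that \<open>X\<close> is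
  homotopically Hausdorff relative to \<open>N\<close> turns this into agreement modulo \<open>N\<close>.\<close>

theorem unique_path_lifting_if_homotopically_Hausdorff_rel:
  assumes N: "subgroup N (fundamental_group X x\<^sub>0)"
    and D: "derived (fundamental_group X x\<^sub>0) (carrier (fundamental_group X x\<^sub>0)) \<subseteq> N"
    and discrete: "discrete (wild_set X)"
    and hH: "homotopically_Hausdorff_rel X x\<^sub>0 N"
  shows "unique_path_lifting (lift_space X x\<^sub>0 N) endpoint_proj"
  unfolding unique_path_lifting_def
proof (intro allI impI, elim conjE)
  fix f g
  assume f: "pathin (lift_space X x\<^sub>0 N) f" and g: "pathin (lift_space X x\<^sub>0 N) g"
    and start: "f 0 = g 0" and proj: "\<forall>t\<in>{0..1}. endpoint_proj (f t) = endpoint_proj (g t)"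
  define E where "E L t \<longleftrightarrow> agree_modulo X L (f t) (g t)" for L t
  have representatives: "\<exists>y. \<exists>\<alpha>\<in>paths_between X x\<^sub>0 y. \<exists>\<beta>\<in>paths_between X x\<^sub>0 y.
      f t = lift_class X x\<^sub>0 N \<alpha> \<and> g t = lift_class X x\<^sub>0 N \<beta> \<and> endpoint_proj (f t) = y"
    if t: "t \<in> {0..1}" for t
  proof -
    obtain y \<alpha> where a: "\<alpha> \<in> paths_between X x\<^sub>0 y" "f t = lift_class X x\<^sub>0 N \<alpha>"
      using pathin_lift_space_representative[OF f t] .
    obtain y' \<beta> where b: "\<beta> \<in> paths_between X x\<^sub>0 y'" "g t = lift_class X x\<^sub>0 N \<beta>"
      using pathin_lift_space_representative[OF g t] .
    have y: "endpoint_proj (f t) = y" "endpoint_proj (g t) = y'"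
      using endpoint_proj_lift_class[OF N a(1)] endpoint_proj_lift_class[OF N b(1)] a(2) b(2) by auto
    then have "y' = y" using proj t by simp
    then show ?thesis using a b y(1) by blast
  qed
  have locally_constant: "\<exists>T. openin (top_of_set {0..1}) T \<and> s \<in> T \<and> (\<forall>r\<in>T. E L r \<longleftrightarrow> E L s)"
    if L: "subgroup L (fundamental_group X x\<^sub>0)" "N \<subseteq> L" and s: "s \<in> {0..1}"
      and U: "openin (top_of_set X) U" "endpoint_proj (f s) \<in> U"
        "absorbs_loops X x\<^sub>0 L (endpoint_proj (f s)) U" for L s U
    using agree_modulo_locally_constant[OF N L f g proj s U] unfolding E_def by metis
  have mono: "E L t" if "E N t" "N \<subseteq> L" for L t
    using that unfolding E_def agree_modulo_def by blast
  have interval: "\<exists>T. openin (top_of_set {0..1}) T \<and> t \<in> T \<and> (\<forall>r\<in>T. \<forall>s\<in>T. E N r \<longrightarrow> E N s)"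
    if t: "t \<in> {0..1}" for t
  proof -
    obtain w \<rho> where \<rho>: "\<rho> \<in> paths_between X x\<^sub>0 w" "f t = lift_class X x\<^sub>0 N \<rho>"
      and ft: "endpoint_proj (f t) = w"
      using representatives[OF t] by blast
    have w: "w \<in> X" using \<rho> by (auto simp: pathfinish_in_path_image)
    show ?thesis
    proof (cases "w \<in> wild_set X")
      case False
      obtain U where "openin (top_of_set X) U" "w \<in> U" "absorbs_loops X x\<^sub>0 N w U"
        using absorbs_loops_if_semilocally_simply_connected[OF N w False] .
      then show ?thesis using locally_constant[OF N subset_refl t, of U] unfolding ft by blast
    next
      case True
      then obtain V where V: "open V" "V \<inter> wild_set X = {w}"
        using discrete unfolding discrete_def isolated_in_def by blast
      have XV: "openin (top_of_set X) (X \<inter> V)" "w \<in> X \<inter> V" using V w by auto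
      obtain T\<^sub>0 where T0: "openin (top_of_set {0..1}) T\<^sub>0" "t \<in> T\<^sub>0"
          "\<forall>s\<in>T\<^sub>0. \<exists>z. \<exists>\<epsilon>\<in>paths_between (X \<inter> V) w z. f s = lift_class X x\<^sub>0 N (\<rho> +++ \<epsilon>)"
        using pathin_lift_space_nearby[OF N f t \<rho> XV] .
      have in_V: "endpoint_proj (f s) \<in> X \<inter> V" if "s \<in> T\<^sub>0" for s
      proof -
        obtain z \<epsilon> where e: "\<epsilon> \<in> paths_between (X \<inter> V) w z" "f s = lift_class X x\<^sub>0 N (\<rho> +++ \<epsilon>)"
          using T0(3) \<open>s \<in> T\<^sub>0\<close> by blast
        have "\<rho> +++ \<epsilon> \<in> paths_between X x\<^sub>0 z" using \<rho> e by (auto simp: path_image_join)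
        then have "endpoint_proj (f s) = z" unfolding e(2) by (rule endpoint_proj_lift_class[OF N])
        moreover have "z \<in> X \<inter> V" using e(1) pathfinish_in_path_image[of \<epsilon>] by auto
        ultimately show ?thesis by simp
      qed
      obtain e where e: "e > 0" "ball t e \<inter> {0..1} \<subseteq> T\<^sub>0"
        using T0(1,2) unfolding openin_contains_ball by blast
      define T where "T = {0..1} \<inter> ball t e"
      have TT0: "T \<subseteq> T\<^sub>0" and T01: "T \<subseteq> {0..1}" using e(2) unfolding T_def by auto
      have T: "openin (top_of_set {0..1}) T" "t \<in> T"
        unfolding T_def using e(1) t by auto
      have conn: "connected T"
        unfolding T_def by (intro convex_connected convex_Int convex_ball convex_real_interval)
      have propagate: "E N s" if r: "r \<in> T" and s: "s \<in> T" and Er: "E N r" for r s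
      proof -
        obtain z \<alpha> \<beta> where ab: "\<alpha> \<in> paths_between X x\<^sub>0 z" "\<beta> \<in> paths_between X x\<^sub>0 z"
            "f s = lift_class X x\<^sub>0 N \<alpha>" "g s = lift_class X x\<^sub>0 N \<beta>"
          using representatives s T01 by blast
        \<comment> \<open>The loop at \<open>w\<close> that transport along \<open>\<rho>\<close> carries to the difference of the
          two lifts at \<open>s\<close>.\<close>
        let ?\<gamma> = "reversepath \<rho> +++ (\<alpha> +++ reversepath \<beta>) +++ \<rho>"
        have \<gamma>: "?\<gamma> \<in> paths_between X w w" using ab \<rho> by (simp add: path_image_join)
        have "path_class X (\<alpha> +++ reversepath \<beta>) \<in> N"
        proof (rule ccontr)
          assume "path_class X (\<alpha> +++ reversepath \<beta>) \<notin> N"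
          moreover have "path_class X (\<rho> +++ ?\<gamma> +++ reversepath \<rho>) = path_class X (\<alpha> +++ reversepath \<beta>)"
            using ab \<rho> by (simp add: groupoid_simps)
          ultimately have "path_class X (\<rho> +++ ?\<gamma> +++ reversepath \<rho>) \<notin> N" by simp
          then obtain U where U: "openin (top_of_set X) U" "w \<in> U"
              "\<forall>\<delta>\<in>paths_between U w w.
                 path_class X (\<rho> +++ ?\<gamma> +++ reversepath \<delta> +++ reversepath \<rho>) \<notin> N"
            using hH[unfolded homotopically_Hausdorff_rel_iff[OF N], rule_format, OF w \<rho>(1) \<gamma>] by blast
          have UX: "U \<subseteq> X" using U openin_imp_subset by blast
          obtain L where L: "subgroup L (fundamental_group X x\<^sub>0)" "N \<subseteq> L" "absorbs_loops X x\<^sub>0 L w U"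
              "\<forall>c\<in>L. \<exists>n\<in>N. \<exists>\<delta>\<in>paths_between U w w.
                 c = class_mult X n (path_class X (\<rho> +++ \<delta> +++ reversepath \<rho>))"
            using adjoin_small_loops[OF N D \<rho>(1) UX U(2)] .
          have "E L s"
          proof (rule connected_induction_simple[OF conn r s])
            show "E L r" using mono[OF Er L(2)] .
            fix a assume a: "a \<in> T"
            then have a01: "a \<in> {0..1}" and aV: "endpoint_proj (f a) \<in> X \<inter> V"
              using T01 TT0 in_V by auto
            have "\<exists>U'. openin (top_of_set X) U' \<and> endpoint_proj (f a) \<in> U' \<and>
                absorbs_loops X x\<^sub>0 L (endpoint_proj (f a)) U'"
            proof (cases "endpoint_proj (f a) = w")
              case True
              then show ?thesis using U L(3) by auto
            next
              case False
              then have tame: "endpoint_proj (f a) \<notin> wild_set X" using V(2) aV by blast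
              obtain U' where U': "openin (top_of_set X) U'" "endpoint_proj (f a) \<in> U'"
                  "absorbs_loops X x\<^sub>0 N (endpoint_proj (f a)) U'"
                using absorbs_loops_if_semilocally_simply_connected[OF N IntD1[OF aV] tame] .
              then show ?thesis using absorbs_loops_mono[OF U'(3) L(2)] by auto
            qed
            then obtain U' where U': "openin (top_of_set X) U'" "endpoint_proj (f a) \<in> U'"
                "absorbs_loops X x\<^sub>0 L (endpoint_proj (f a)) U'" by (elim exE conjE)
            obtain S where S: "openin (top_of_set {0..1}) S" "a \<in> S" "\<forall>r\<in>S. E L r \<longleftrightarrow> E L a"
              using locally_constant[OF L(1,2) a01 U'] by (elim exE conjE)
            have "openin (top_of_set T) (T \<inter> S)"
              using S(1) T01 by (auto simp: openin_open)
            moreover have "a \<in> T \<inter> S" using a S(2) by simp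
            moreover have "\<forall>x\<in>T \<inter> S. \<forall>y\<in>T \<inter> S. E L x \<longrightarrow> E L y" using S(3) by simp
            ultimately show "\<exists>S. openin (top_of_set T) S \<and> a \<in> S \<and> (\<forall>x\<in>S. \<forall>y\<in>S. E L x \<longrightarrow> E L y)"
              by (intro exI[of _ "T \<inter> S"] conjI)
          qed
          then have "path_class X (\<alpha> +++ reversepath \<beta>) \<in> L"
            unfolding E_def ab(3,4) agree_modulo_lift_class_iff[OF N L(1,2) ab(1,2)] .
          then obtain n \<delta> where n: "n \<in> N" and d: "\<delta> \<in> paths_between U w w"
            and eq: "path_class X (\<alpha> +++ reversepath \<beta>)
              = class_mult X n (path_class X (\<rho> +++ \<delta> +++ reversepath \<rho>))"
            using L(4) by blast
          obtain p where p: "p \<in> paths_between X x\<^sub>0 x\<^sub>0" "n = path_class X p"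
            using subgroup_class_of_loop[OF N n] .
          have dX: "\<delta> \<in> paths_between X w w" using d UX by auto
          have "path_class X (\<rho> +++ ?\<gamma> +++ reversepath \<delta> +++ reversepath \<rho>)
              = class_mult X (path_class X (\<alpha> +++ reversepath \<beta>))
                  (path_class X (\<rho> +++ reversepath \<delta> +++ reversepath \<rho>))"
            using ab(1,2) \<rho> dX by (simp add: groupoid_simps)
          also have "\<dots> = n"
            unfolding eq p(2) using p(1) \<rho> dX by (simp add: groupoid_simps)
          finally have "path_class X (\<rho> +++ ?\<gamma> +++ reversepath \<delta> +++ reversepath \<rho>) \<in> N"
            using n by (rule ssubst)
          then show False using U(3) d by blast
        qed
        then show "E N s"
          unfolding E_def ab(3,4) agree_modulo_lift_class_iff[OF N N subset_refl ab(1,2)] .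
      qed
      then show ?thesis using T by blast
    qed
  qed
  show "\<forall>t\<in>{0..1}. f t = g t"
  proof
    fix t :: real assume t: "t \<in> {0..1}"
    have "E N 0"
    proof -
      obtain y \<alpha> where "\<alpha> \<in> paths_between X x\<^sub>0 y" "f 0 = lift_class X x\<^sub>0 N \<alpha>"
        using representatives[of 0] by auto
      then show ?thesis
        unfolding E_def start[symmetric]
        using agree_modulo_lift_class_iff[OF N N subset_refl] lift_class_eq_iff[OF N] by metis
    qed
    then have "E N t"
      using connected_induction_simple[OF convex_connected[OF convex_real_interval(5)], of 0 0 1 t "E N"]
        interval t by auto
    moreover obtain z \<alpha> \<beta> where ab: "\<alpha> \<in> paths_between X x\<^sub>0 z" "\<beta> \<in> paths_between X x\<^sub>0 z"
        "f t = lift_class X x\<^sub>0 N \<alpha>" "g t = lift_class X x\<^sub>0 N \<beta>"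
      using representatives[OF t] by blast
    ultimately show "f t = g t"
      unfolding E_def ab(3,4) agree_modulo_lift_class_iff[OF N N subset_refl ab(1,2)]
        lift_class_eq_iff[OF N ab(1,2)] by simp
  qed
qed

section \<open>Infinite concatenations\<close>

text \<open>The piece \<open>h n\<close> runs from time \<open>(n - 1) / n\<close> to time \<open>n / (n + 1)\<close>; the pieces
  are numbered from 1.  This is the schedule of the infinite earring loop.\<close>

definition infinite_concat :: "(nat \<Rightarrow> real \<Rightarrow> 'b) \<Rightarrow> 'b \<Rightarrow> real \<Rightarrow> 'b" where
  "infinite_concat h b t =
     (if t < 1
      then let n = nat \<lfloor>1 / (1 - t)\<rfloor>
           in h n ((t - (real n - 1) / real n) * (real n * (real n + 1)))
      else b)"

lemma earring_loop_inf_eq: "earring_loop_inf = infinite_concat earring_loop (0, 0)"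
  by (simp add: fun_eq_iff earring_loop_inf_def infinite_concat_def)

lemma infinite_concat_one [simp]: "infinite_concat h b 1 = b"
  by (simp add: infinite_concat_def)

lemma floor_interval:
  assumes n: "n \<ge> 1" and t: "(real n - 1) / real n \<le> t" "t < real n / (real n + 1)"
  shows "nat \<lfloor>1 / (1 - t)\<rfloor> = n" and "t < 1"
proof -
  have "real n / (real n + 1) < 1" using n by simp
  then show t1: "t < 1" using t by linarith
  have "(1 - t) * real n \<le> 1" using t(1) n by (simp add: field_simps)
  then have "real n \<le> 1 / (1 - t)" using t1 by (simp add: field_simps)
  moreover have "1 < (1 - t) * (real n + 1)" using t(2) n by (simp add: field_simps)
  then have "1 / (1 - t) < real n + 1" using t1 by (simp add: field_simps)
  ultimately have "\<lfloor>1 / (1 - t)\<rfloor> = int n" by (simp add: floor_eq_iff)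
  then show "nat \<lfloor>1 / (1 - t)\<rfloor> = n" by simp
qed

lemma obtain_interval:
  assumes t: "0 \<le> t" "t < (1::real)"
  obtains n where "n \<ge> 1" "(real n - 1) / real n \<le> t" "t < real n / (real n + 1)"
proof
  define m where "m = nat \<lfloor>1 / (1 - t)\<rfloor>"
  have "1 / (1 - t) \<ge> 1" using t by (simp add: field_simps)
  then have fl: "\<lfloor>1 / (1 - t)\<rfloor> = int m" unfolding m_def by linarith
  have le: "real m \<le> 1 / (1 - t)" and less: "1 / (1 - t) < real m + 1"
    using floor_correct[of "1 / (1 - t)"] unfolding fl by simp_all
  show m: "m \<ge> 1" using less \<open>1 / (1 - t) \<ge> 1\<close> by linarith
  have "(1 - t) * real m \<le> 1" using le t by (simp add: field_simps)
  then show "(real m - 1) / real m \<le> t" using m by (simp add: field_simps)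
  have "1 < (1 - t) * (real m + 1)" using less t by (simp add: field_simps)
  then show "t < real m / (real m + 1)" using m by (simp add: field_simps)
qed

lemma interval_length:
  assumes n: "n \<ge> (1::nat)"
  shows "(real n / (real n + 1) - (real n - 1) / real n) * (real n * (real n + 1)) = 1"
proof -
  have "real n / (real n + 1) * (real n * (real n + 1)) = real n * real n"
    "(real n - 1) / real n * (real n * (real n + 1)) = (real n - 1) * (real n + 1)"
    using n by simp_all
  then show ?thesis unfolding left_diff_distrib by (simp add: algebra_simps)
qed

lemma local_coordinate_bounds:
  assumes n: "n \<ge> (1::nat)"
  shows "(real n - 1) / real n \<le> t \<Longrightarrow> 0 \<le> (t - (real n - 1) / real n) * (real n * (real n + 1))"
    and "t \<le> real n / (real n + 1) \<Longrightarrow> (t - (real n - 1) / real n) * (real n * (real n + 1)) \<le> 1"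
    and "t < real n / (real n + 1) \<Longrightarrow> (t - (real n - 1) / real n) * (real n * (real n + 1)) < 1"
proof -
  have pos: "real n * (real n + 1) > 0" using n by simp
  note len = interval_length[OF n]
  show "0 \<le> (t - (real n - 1) / real n) * (real n * (real n + 1))" if "(real n - 1) / real n \<le> t"
    using that pos by (intro mult_nonneg_nonneg) auto
  show "(t - (real n - 1) / real n) * (real n * (real n + 1)) \<le> 1" if "t \<le> real n / (real n + 1)"
  proof -
    have "(t - (real n - 1) / real n) * (real n * (real n + 1))
        \<le> (real n / (real n + 1) - (real n - 1) / real n) * (real n * (real n + 1))"
      using that pos by (intro mult_right_mono) auto
    then show ?thesis unfolding len .
  qed
  show "(t - (real n - 1) / real n) * (real n * (real n + 1)) < 1" if "t < real n / (real n + 1)"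
  proof -
    have "(t - (real n - 1) / real n) * (real n * (real n + 1))
        < (real n / (real n + 1) - (real n - 1) / real n) * (real n * (real n + 1))"
      using that pos by (intro mult_strict_right_mono) auto
    then show ?thesis unfolding len .
  qed
qed

lemma infinite_concat_eq:
  assumes n: "n \<ge> 1" and t: "(real n - 1) / real n \<le> t" "t \<le> real n / (real n + 1)"
    and match: "h n 1 = h (Suc n) 0"
  shows "infinite_concat h b t = h n ((t - (real n - 1) / real n) * (real n * (real n + 1)))"
proof (cases "t = real n / (real n + 1)")
  case True
  have "real (Suc n) / (real (Suc n) + 1) > t" unfolding True by (simp add: field_simps)
  moreover have eq: "(real (Suc n) - 1) / real (Suc n) = t" unfolding True by (simp add: add.commute)
  ultimately have fl: "nat \<lfloor>1 / (1 - t)\<rfloor> = Suc n" "t < 1" using floor_interval[of "Suc n" t] by auto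
  have "infinite_concat h b t = h (Suc n) 0"
    unfolding infinite_concat_def Let_def fl using eq fl by simp
  moreover have "(t - (real n - 1) / real n) * (real n * (real n + 1)) = 1"
    unfolding True using interval_length[OF n] .
  ultimately show ?thesis using match by simp
next
  case False
  then have "t < real n / (real n + 1)" using t by simp
  from floor_interval[OF n t(1) this] show ?thesis by (simp add: infinite_concat_def)
qed

definition piece_index :: "real \<Rightarrow> nat" where
  "piece_index t = nat \<lfloor>1 / (1 - t)\<rfloor>"

definition piece_coordinate :: "real \<Rightarrow> real" where
  "piece_coordinate t =
     (t - (real (piece_index t) - 1) / real (piece_index t))
       * (real (piece_index t) * (real (piece_index t) + 1))"

text \<open>The time at which the piece \<open>n\<close> has coordinate \<open>u\<close>.\<close>

definition piece_time :: "nat \<Rightarrow> real \<Rightarrow> real" where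
  "piece_time n u = (real n - 1) / real n + u / (real n * (real n + 1))"

lemma infinite_concat_less_one:
  "t < 1 \<Longrightarrow> infinite_concat h b t = h (piece_index t) (piece_coordinate t)"
  by (simp add: infinite_concat_def piece_index_def piece_coordinate_def Let_def)

lemma piece_bounds:
  assumes "0 \<le> t" "t < 1"
  shows "piece_index t \<ge> 1" "piece_coordinate t \<in> {0..<1}"
    "t < real (piece_index t) / (real (piece_index t) + 1)"
proof -
  obtain n where n: "n \<ge> 1" "(real n - 1) / real n \<le> t" "t < real n / (real n + 1)"
    using obtain_interval[OF assms] .
  have "piece_index t = n" using floor_interval[OF n] by (simp add: piece_index_def)
  then show "piece_index t \<ge> 1" "piece_coordinate t \<in> {0..<1}"
      "t < real (piece_index t) / (real (piece_index t) + 1)"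
    using n local_coordinate_bounds[OF n(1), of t] by (auto simp: piece_coordinate_def)
qed

lemma piece_time_bounds:
  assumes n: "n \<ge> 1" and u: "u \<in> {0..1}"
  shows "(real n - 1) / real n \<le> piece_time n u" "piece_time n u \<le> real n / (real n + 1)"
    "piece_time n u \<in> {0..1}"
proof -
  have pos: "real n * (real n + 1) > 0" using n by simp
  show lower: "(real n - 1) / real n \<le> piece_time n u"
    using u pos unfolding piece_time_def by simp
  have "piece_time n u \<le> (real n - 1) / real n + 1 / (real n * (real n + 1))"
    using u pos unfolding piece_time_def by (intro add_left_mono divide_right_mono) auto
  also have "\<dots> = real n / (real n + 1)"
  proof -
    have "real n / (real n + 1) - (real n - 1) / real n = 1 / (real n * (real n + 1))"
      using interval_length[OF n] pos by (metis nonzero_eq_divide_eq less_irrefl)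
    then show ?thesis by linarith
  qed
  finally show upper: "piece_time n u \<le> real n / (real n + 1)" .
  have "(real n - 1) / real n \<ge> 0" "real n / (real n + 1) \<le> 1" using n by simp_all
  then show "piece_time n u \<in> {0..1}" using lower upper unfolding atLeastAtMost_iff by linarith
qed

lemma infinite_concat_piece_time:
  assumes n: "n \<ge> 1" and u: "u \<in> {0..1}" and match: "h n 1 = h (Suc n) 0"
  shows "infinite_concat h b (piece_time n u) = h n u"
proof -
  have "real n * (real n + 1) \<noteq> 0" using n by simp
  then have "(piece_time n u - (real n - 1) / real n) * (real n * (real n + 1)) = u"
    unfolding piece_time_def by simp
  then show ?thesis
    using infinite_concat_eq[where h = h and b = b, OF n piece_time_bounds(1,2)[OF n u] match] by simp
qed

text \<open>Only finitely many pieces meet a neighborhood of a time \<open>t < 1\<close>; at \<open>t = 1\<close> continuity comes from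
  the pieces shrinking to \<open>b\<close>.  The extra parameter \<open>s\<close> makes the statement apply to
  homotopies, whose intermediate pieces need not be loops.\<close>

lemma continuous_on_infinite_concat:
  fixes h :: "nat \<Rightarrow> 'c::metric_space \<Rightarrow> real \<Rightarrow> 'b::metric_space"
  assumes S: "closed S"
    and cont: "\<And>n. n \<ge> 1 \<Longrightarrow> continuous_on (S \<times> {0..1}) (\<lambda>p. h n (fst p) (snd p))"
    and match: "\<And>n s. n \<ge> 1 \<Longrightarrow> s \<in> S \<Longrightarrow> h n s 1 = h (Suc n) s 0"
    and small: "\<And>e. e > 0 \<Longrightarrow> \<exists>M. \<forall>n\<ge>M. \<forall>s\<in>S. \<forall>u\<in>{0..1}. dist (h n s u) b < e"
  shows "continuous_on (S \<times> {0..1}) (\<lambda>p. infinite_concat (\<lambda>n. h n (fst p)) b (snd p))"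
proof -
  let ?G = "\<lambda>p. infinite_concat (\<lambda>n. h n (fst p)) b (snd p)"
  have strip: "continuous_on (S \<times> {(real n - 1) / real n..real n / (real n + 1)}) ?G" if n: "n \<ge> 1" for n
  proof (rule continuous_on_eq)
    let ?u = "\<lambda>t. (t - (real n - 1) / real n) * (real n * (real n + 1))"
    show "continuous_on (S \<times> {(real n - 1) / real n..real n / (real n + 1)})
        (\<lambda>p. (\<lambda>p. h n (fst p) (snd p)) (fst p, ?u (snd p)))"
    proof (rule continuous_on_compose2[OF cont[OF n]])
      show "(\<lambda>p. (fst p, ?u (snd p))) ` (S \<times> {(real n - 1) / real n..real n / (real n + 1)}) \<subseteq> S \<times> {0..1}"
        using local_coordinate_bounds[OF n] by auto
    qed (intro continuous_intros)
    show "(\<lambda>p. h n (fst p) (snd p)) (fst p, ?u (snd p)) = ?G p"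
      if "p \<in> S \<times> {(real n - 1) / real n..real n / (real n + 1)}" for p
      using that infinite_concat_eq[OF n, of "snd p" "\<lambda>n. h n (fst p)" b] match[OF n, of "fst p"] by auto
  qed
  have initial: "continuous_on (S \<times> {0..real n / (real n + 1)}) ?G" for n
  proof (induction n)
    case 0
    show ?case using strip[of 1] by (rule continuous_on_subset) auto
  next
    case (Suc n)
    have "continuous_on (S \<times> {real n / (real n + 1)..real (Suc n) / (real (Suc n) + 1)}) ?G"
      using strip[of "Suc n"] by (simp add: add.commute)
    with Suc have "continuous_on (S \<times> {0..real n / (real n + 1)} \<union>
        S \<times> {real n / (real n + 1)..real (Suc n) / (real (Suc n) + 1)}) ?G"
      by (intro continuous_on_closed_Un closed_Times S closed_real_atLeastAtMost)
    then show ?case by (rule continuous_on_subset) auto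
  qed
  show ?thesis
    unfolding continuous_on_eq_continuous_within
  proof
    fix p assume p: "p \<in> S \<times> {0..1::real}"
    show "continuous (at p within S \<times> {0..1}) ?G"
    proof (cases "snd p < 1")
      case True
      then obtain n where n: "n \<ge> 1" "snd p < real n / (real n + 1)"
        using p obtain_interval[of "snd p"] by (metis SigmaE atLeastAtMost_iff snd_conv)
      define c where "c = real n / (real n + 1)"
      have c: "c \<le> 1" "snd p < c" using n(2) by (auto simp: c_def)
      then have eq: "at p within S \<times> {0..1} = at p within S \<times> {0..c}"
        by (intro at_within_nhd[of p "UNIV \<times> {..<c}"]) (auto simp: mem_Times_iff open_Times)
      have "p \<in> S \<times> {0..c}" using p c by auto
      then show ?thesis
        unfolding eq using initial[of n] unfolding continuous_on_eq_continuous_within c_def by blast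
    next
      case False
      then have p1: "snd p = 1" using p by auto
      have "((\<lambda>p. ?G p) \<longlongrightarrow> b) (at p within S \<times> {0..1})"
      proof (rule tendstoI)
        fix e :: real assume e: "e > 0"
        obtain M where M: "\<forall>n\<ge>M. \<forall>s\<in>S. \<forall>u\<in>{0..1}. dist (h n s u) b < e" using small[OF e] by blast
        let ?W = "UNIV \<times> {real M / (real M + 1)<..} :: ('c \<times> real) set"
        have "dist (?G q) b < e" if q: "q \<in> ?W" "q \<in> S \<times> {0..1}" for q
        proof -
          have q01: "snd q \<in> {0..1}" using q by auto
          show ?thesis
          proof (cases "snd q = 1")
            case True
            then show ?thesis using e by simp
          next
            case False
            let ?n = "piece_index (snd q)" and ?u = "piece_coordinate (snd q)"
            have q1: "snd q < 1" using q01 False by simp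
            then have bounds: "?n \<ge> 1" "?u \<in> {0..<1}" "snd q < real ?n / (real ?n + 1)"
              using piece_bounds[of "snd q"] q01 by auto
            have "M \<le> ?n"
            proof (rule ccontr)
              assume "\<not> M \<le> ?n"
              then have "real ?n / (real ?n + 1) \<le> real M / (real M + 1)"
                by (simp add: field_simps)
              then show False using bounds(3) q by auto
            qed
            moreover have "?u \<in> {0..1}" "fst q \<in> S" using bounds(2) q by auto
            ultimately show ?thesis using M infinite_concat_less_one[OF q1] by metis
          qed
        qed
        moreover have "open ?W" by (intro open_Times) auto
        moreover have "p \<in> ?W" using p1 by (auto simp: mem_Times_iff)
        ultimately show "\<forall>\<^sub>F q in at p within S \<times> {0..1}. dist (?G q) b < e"
          unfolding eventually_at_topological by blast
      qed
      then show ?thesis unfolding continuous_within p1 by simp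
    qed
  qed
qed

corollary path_infinite_concat:
  fixes h :: "nat \<Rightarrow> real \<Rightarrow> 'b::metric_space"
  assumes "\<And>n. n \<ge> 1 \<Longrightarrow> path (h n)"
    and "\<And>n. n \<ge> 1 \<Longrightarrow> pathfinish (h n) = pathstart (h (Suc n))"
    and small: "\<And>e. e > 0 \<Longrightarrow> \<exists>M. \<forall>n\<ge>M. \<forall>u\<in>{0..1}. dist (h n u) b < e"
  shows "path (infinite_concat h b)"
proof -
  have "continuous_on ({0::real} \<times> {0..1}) (\<lambda>p. infinite_concat (\<lambda>n. h n) b (snd p))"
  proof (rule continuous_on_infinite_concat[where h = "\<lambda>n _. h n"])
    show "continuous_on ({0::real} \<times> {0..1}) (\<lambda>p. h n (snd p))" if "n \<ge> 1" for n
      using assms(1)[OF that] unfolding path_def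
      by (rule continuous_on_compose2) (auto intro!: continuous_intros)
    show "h n 1 = h (Suc n) 0" if "n \<ge> 1" for n
      using assms(2)[OF that] by (simp add: pathstart_def pathfinish_def)
  qed (use small in auto)
  then have "continuous_on {0..1} (\<lambda>t. (\<lambda>p. infinite_concat h b (snd p)) (0::real, t))"
    by (rule continuous_on_compose2) (auto intro!: continuous_intros)
  then show ?thesis by (simp add: path_def)
qed

lemma path_image_infinite_concat:
  assumes "\<And>n. n \<ge> 1 \<Longrightarrow> path_image (h n) \<subseteq> X" "b \<in> X"
  shows "path_image (infinite_concat h b) \<subseteq> X"
proof -
  have "infinite_concat h b t \<in> X" if t: "t \<in> {0..1}" for t
  proof (cases "t = 1")
    case False
    then have "t < 1" "0 \<le> t" using t by auto
    then show ?thesis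
      using piece_bounds[of t] assms(1)[of "piece_index t"]
      by (auto simp: infinite_concat_less_one path_image_def)
  qed (use assms in simp)
  then show ?thesis by (auto simp: path_image_def)
qed

section \<open>Maps out of the Hawaiian earring\<close>

lemma earring_loop_ends [simp]: "earring_loop n 0 = (0, 0)" "earring_loop n 1 = (0, 0)"
proof -
  have "cos (pi + 2 * pi) = -1" "sin (pi + 2 * pi) = 0"
    by (simp_all add: cos_add sin_add)
  then show "earring_loop n 0 = (0, 0)" "earring_loop n 1 = (0, 0)"
    by (simp_all add: earring_loop_def)
qed

lemma path_earring_loop: "path (earring_loop n)"
  unfolding path_def earring_loop_def by (cases "n = 0") (auto intro!: continuous_intros)

lemma earring_loop_in_circle:
  assumes "n \<ge> 1"
  shows "earring_loop n t \<in> sphere (1 / real n, 0) (1 / real n)"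
proof -
  have "dist (1 / real n, 0) (earring_loop n t)
      = sqrt ((cos (pi + 2 * pi * t) / real n)\<^sup>2 + (sin (pi + 2 * pi * t) / real n)\<^sup>2)"
    by (simp add: earring_loop_def dist_Pair_Pair dist_real_def power_divide)
  also have "(cos (pi + 2 * pi * t) / real n)\<^sup>2 + (sin (pi + 2 * pi * t) / real n)\<^sup>2 = (1 / real n)\<^sup>2"
    by (simp add: power_divide flip: add_divide_distrib)
  finally show ?thesis using assms by simp
qed

lemma earring_circle_iff:
  assumes "n \<ge> 1"
  shows "(x, y) \<in> sphere (1 / real n, 0) (1 / real n) \<longleftrightarrow> x\<^sup>2 + y\<^sup>2 = 2 * x / real n"
proof -
  have "(x, y) \<in> sphere (1 / real n, 0) (1 / real n) \<longleftrightarrow> sqrt ((1 / real n - x)\<^sup>2 + y\<^sup>2) = sqrt ((1 / real n)\<^sup>2)"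
    by (simp add: dist_Pair_Pair dist_real_def)
  also have "\<dots> \<longleftrightarrow> (1 / real n - x)\<^sup>2 + y\<^sup>2 = (1 / real n)\<^sup>2" by (rule real_sqrt_eq_iff)
  also have "\<dots> \<longleftrightarrow> x\<^sup>2 + y\<^sup>2 = 2 * x / real n"
    by (auto simp: power2_diff)
  finally show ?thesis .
qed

lemma earring_origin:
  assumes "z \<in> earring" "fst z \<le> 0"
  shows "z = (0, 0)"
proof -
  obtain n x y where n: "n \<ge> 1" and z: "z = (x, y)" and "(x, y) \<in> sphere (1 / real n, 0) (1 / real n)"
    using assms(1) unfolding earring_def by (cases z) auto
  then have eq: "x\<^sup>2 + y\<^sup>2 = 2 * x / real n" using earring_circle_iff by blast
  then have "2 * x / real n \<ge> 0" by (metis sum_power2_ge_zero)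
  then have "x \<ge> 0" using n by (simp add: zero_le_divide_iff zero_le_mult_iff)
  then have "x = 0" using z assms(2) by simp
  then show "z = (0, 0)" using eq z by simp
qed

lemma earring_loop_fst_pos:
  assumes n: "n \<ge> 1" and u: "u \<in> {0<..<1}"
  shows "fst (earring_loop n u) > 0"
proof -
  have "cos (2 * pi * u) \<noteq> 1"
  proof
    assume "cos (2 * pi * u) = 1"
    then obtain k :: int where "2 * pi * u = real_of_int k * 2 * pi" unfolding cos_one_2pi_int by blast
    then have "u = real_of_int k" by simp
    then have "0 < k" "k < 1" using u by simp_all
    then show False by linarith
  qed
  moreover have "cos (2 * pi * u) \<le> 1" by simp
  ultimately have "1 - cos (2 * pi * u) > 0" by linarith
  moreover have "fst (earring_loop n u) = (1 - cos (2 * pi * u)) / real n"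
    by (simp add: earring_loop_def cos_add diff_divide_distrib)
  ultimately show ?thesis using n by simp
qed

lemma earring_loop_inj:
  assumes n: "n \<ge> 1" "m \<ge> 1" and u: "u \<in> {0<..<1}" "v \<in> {0<..<1}"
    and eq: "earring_loop n u = earring_loop m v"
  shows "n = m \<and> u = v"
proof -
  obtain x y where xy: "earring_loop n u = (x, y)" by (cases "earring_loop n u")
  have "x > 0" using earring_loop_fst_pos[OF n(1) u(1)] xy by simp
  have "x\<^sup>2 + y\<^sup>2 = 2 * x / real n" "x\<^sup>2 + y\<^sup>2 = 2 * x / real m"
    using earring_loop_in_circle[OF n(1), of u] earring_loop_in_circle[OF n(2), of v] xy
    unfolding eq[symmetric] xy earring_circle_iff[OF n(1)] earring_circle_iff[OF n(2)] by auto
  then have "2 * x / real n = 2 * x / real m" by (rule trans[OF sym])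
  then have "x = 0 \<or> m = n" using n by (simp add: divide_simps)
  then have nm: "n = m" using \<open>x > 0\<close> by simp
  have "cos (pi + 2 * pi * u) = cos (pi + 2 * pi * v)" "sin (pi + 2 * pi * u) = sin (pi + 2 * pi * v)"
    using eq n unfolding nm earring_loop_def by auto
  then obtain k :: int where "pi + 2 * pi * u = pi + 2 * pi * v + 2 * pi * real_of_int k"
    using sin_cos_eq_iff by metis
  then have "2 * pi * u = 2 * pi * (v + real_of_int k)" by (simp add: algebra_simps)
  then have uv: "u = v + real_of_int k" by simp
  then have "\<bar>real_of_int k\<bar> < 1" using u by auto
  then have "k = 0" by linarith
  then show ?thesis using nm uv by simp
qed

lemma earring_loop_surj:
  assumes n: "n \<ge> 1" and z: "z \<in> sphere (1 / real n, 0) (1 / real n)"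
  obtains u where "u \<in> {0..1}" "z = earring_loop n u"
proof -
  obtain x y where xy: "z = (x, y)" by (cases z)
  have "x\<^sup>2 + y\<^sup>2 = 2 * x / real n" using z earring_circle_iff[OF n] xy by blast
  then have "(real n)\<^sup>2 * (x\<^sup>2 + y\<^sup>2) = 2 * x * real n" using n by (simp add: power2_eq_square)
  then have "(1 - real n * x)\<^sup>2 + (- real n * y)\<^sup>2 = 1"
    by (simp add: power2_eq_square algebra_simps)
  then obtain t where t: "0 \<le> t" "t < 2 * pi" "1 - real n * x = cos t" "- real n * y = sin t"
    using sincos_total_2pi by blast
  have "z = earring_loop n (t / (2 * pi))"
    using t(3,4) n unfolding xy earring_loop_def by (simp add: field_simps)
  moreover have "t / (2 * pi) \<in> {0..1}" using t(1,2) by simp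
  ultimately show ?thesis using that by blast
qed

lemma earring_loop_shrinks:
  assumes "e > 0"
  shows "\<exists>M. \<forall>n\<ge>M. \<forall>u\<in>{0..1}. dist (earring_loop n u) (0, 0) < e"
proof -
  obtain M where M: "real M > 2 / e" using reals_Archimedean2 by blast
  have "dist (earring_loop n u) (0, 0) < e" if "n \<ge> M" for n u
  proof -
    have n: "n \<ge> 1" and "real n > 2 / e" using M that assms
      by (smt (verit) divide_pos_pos of_nat_le_iff less_one not_le of_nat_0)+
    then have "2 / real n < e" using assms by (simp add: field_simps)
    have "dist (earring_loop n u) (1 / real n, 0) = 1 / real n"
      using earring_loop_in_circle[OF n] by (simp add: dist_commute)
    moreover have "dist (1 / real n, 0) (0, 0 :: real) = 1 / real n"
      by (simp add: dist_Pair_Pair dist_real_def)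
    ultimately have "dist (earring_loop n u) (0, 0) \<le> 2 / real n"
      using dist_triangle[of "earring_loop n u" "(0, 0)" "(1 / real n, 0)"] by simp
    then show ?thesis using \<open>2 / real n < e\<close> by simp
  qed
  then show ?thesis by blast
qed

lemma path_earring_loop_inf: "path earring_loop_inf"
  unfolding earring_loop_inf_eq
  by (rule path_infinite_concat)
    (simp_all add: path_earring_loop earring_loop_shrinks pathstart_def pathfinish_def)

lemma path_image_earring_loop_inf: "path_image earring_loop_inf = earring"
proof
  have "path_image (earring_loop n) \<subseteq> earring" if "n \<ge> 1" for n
    using earring_loop_in_circle[OF that] that unfolding earring_def path_image_def by auto
  moreover have "(0, 0) \<in> earring"
    using earring_loop_in_circle[of 1 0] unfolding earring_def by force
  ultimately show "path_image earring_loop_inf \<subseteq> earring"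
    unfolding earring_loop_inf_eq by (intro path_image_infinite_concat)
  show "earring \<subseteq> path_image earring_loop_inf"
  proof
    fix z assume "z \<in> earring"
    then obtain n where n: "n \<ge> 1" "z \<in> sphere (1 / real n, 0) (1 / real n)"
      unfolding earring_def by auto
    obtain u where u: "u \<in> {0..1}" "z = earring_loop n u" using earring_loop_surj[OF n] .
    have "earring_loop_inf (piece_time n u) = z"
      unfolding earring_loop_inf_eq u(2) by (rule infinite_concat_piece_time[OF n(1) u(1)]) simp
    then show "z \<in> path_image earring_loop_inf" 
      using piece_time_bounds(3)[OF n(1) u(1)] unfolding path_image_def by blast
  qed
qed

text \<open>A continuous map from a compact space to a Hausdorff space is closed, hence a quotient map onto
  its image.\<close>

lemma continuous_on_factor_compact:
  fixes e :: "'a::topological_space \<Rightarrow> 'b::t2_space" and q :: "'a \<Rightarrow> 'c::topological_space"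
  assumes K: "compact K" and e: "continuous_on K e" and q: "continuous_on K q"
    and fibres: "\<And>s t. s \<in> K \<Longrightarrow> t \<in> K \<Longrightarrow> e s = e t \<Longrightarrow> q s = q t"
  obtains g where "continuous_on (e ` K) g" "\<forall>t\<in>K. g (e t) = q t"
proof
  let ?g = "\<lambda>z. q (SOME t. t \<in> K \<and> e t = z)"
  show g: "\<forall>t\<in>K. ?g (e t) = q t"
  proof
    fix t assume t: "t \<in> K"
    have "(SOME s. s \<in> K \<and> e s = e t) \<in> K \<and> e (SOME s. s \<in> K \<and> e s = e t) = e t"
      by (rule someI[of _ t]) (use t in simp)
    then show "?g (e t) = q t" using fibres t by blast
  qed
  show "continuous_on (e ` K) ?g"
    unfolding continuous_on_closed_invariant
  proof (intro allI impI)
    fix B :: "'c set" assume "closed B"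
    have "compact {t \<in> K. q t \<in> B}"
    proof -
      obtain A where A: "closed A" "A \<inter> K = q -` B \<inter> K"
        using q \<open>closed B\<close> unfolding continuous_on_closed_invariant by blast
      have "{t \<in> K. q t \<in> B} = A \<inter> K" using A(2) by auto
      then show ?thesis using A(1) K by (simp add: closed_Int_compact)
    qed
    then have "closed (e ` {t \<in> K. q t \<in> B})"
      by (intro compact_imp_closed compact_continuous_image continuous_on_subset[OF e]) auto
    moreover have "e ` {t \<in> K. q t \<in> B} \<inter> e ` K = ?g -` B \<inter> e ` K"
      using g by auto
    ultimately show "\<exists>A. closed A \<and> A \<inter> e ` K = ?g -` B \<inter> e ` K" by blast
  qed
qed

text \<open>A map on the earring with a whisker amounts to a path followed by a sequence of loops
  shrinking to its endpoint: the infinite loop is a closed surjection onto the earring, and its only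
  nontrivial fibre is the one over the origin.\<close>

lemma earring_plus_map:
  fixes X :: "'a::metric_space set"
  assumes a: "\<alpha> \<in> paths_between X x\<^sub>0 x"
    and d: "\<And>n. n \<ge> 1 \<Longrightarrow> d n \<in> paths_between X x x"
    and small: "\<And>e. e > 0 \<Longrightarrow> \<exists>M. \<forall>n\<ge>M. \<forall>u\<in>{0..1}. dist (d n u) x < e"
  obtains f where "continuous_on earring_plus f" "f ` earring_plus \<subseteq> X" "f (-1, 0) = x\<^sub>0"
    "\<forall>t\<in>{0..1}. f (whisker t) = \<alpha> t"
    "\<forall>n\<ge>1. \<forall>u\<in>{0..1}. f (earring_loop n u) = d n u"
    "\<forall>t\<in>{0..1}. f (earring_loop_inf t) = infinite_concat d x t"
proof -
  have x: "x \<in> X" using a by (auto simp: pathfinish_in_path_image)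
  have d_ends: "d n 0 = x" "d n 1 = x" if "n \<ge> 1" for n
    using d[OF that] by (auto simp: pathstart_def pathfinish_def)
  have q: "path (infinite_concat d x)"
    using d small by (intro path_infinite_concat) auto
  have qX: "path_image (infinite_concat d x) \<subseteq> X"
    using d x by (intro path_image_infinite_concat) auto
  \<comment> \<open>Both infinite products run through their pieces on the same schedule.\<close>
  have on_piece: "earring_loop_inf t = (0, 0) \<and> infinite_concat d x t = x \<or>
      (\<exists>n u. n \<ge> 1 \<and> u \<in> {0<..<1} \<and> earring_loop_inf t = earring_loop n u \<and> infinite_concat d x t = d n u)"
    if t: "t \<in> {0..1}" for t
  proof (cases "t = 1")
    case True
    then show ?thesis by (simp add: earring_loop_inf_eq)
  next
    case False
    then have t1: "t < 1" "0 \<le> t" using t by auto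
    note b = piece_bounds[OF t1(2,1)]
    show ?thesis
    proof (cases "piece_coordinate t = 0")
      case True
      then show ?thesis using d_ends(1)[OF b(1)] t1
        by (simp add: earring_loop_inf_eq infinite_concat_less_one)
    next
      case False
      then have "piece_coordinate t \<in> {0<..<1}" using b(2) by auto
      then show ?thesis using b(1) t1
        unfolding earring_loop_inf_eq infinite_concat_less_one[OF t1(1)] by blast
    qed
  qed
  obtain g where g: "continuous_on earring g" "\<forall>t\<in>{0..1}. g (earring_loop_inf t) = infinite_concat d x t"
  proof (rule continuous_on_factor_compact[of "{0..1::real}" earring_loop_inf "infinite_concat d x"])
    show "continuous_on {0..1} earring_loop_inf" using path_earring_loop_inf by (simp add: path_def)
    show "continuous_on {0..1} (infinite_concat d x)" using q by (simp add: path_def)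
    fix s t :: real assume st: "s \<in> {0..1}" "t \<in> {0..1}" and eq: "earring_loop_inf s = earring_loop_inf t"
    have nz: "earring_loop n u \<noteq> (0, 0)" if "n \<ge> 1" "u \<in> {0<..<1}" for n u
      using earring_loop_fst_pos[OF that] by auto
    show "infinite_concat d x s = infinite_concat d x t"
      using on_piece[OF st(1)] on_piece[OF st(2)]
    proof (elim disjE exE conjE)
      fix n u m v
      assume h: "1 \<le> n" "1 \<le> m" "u \<in> {0<..<1}" "v \<in> {0<..<1}"
        "earring_loop_inf s = earring_loop n u" "earring_loop_inf t = earring_loop m v"
        "infinite_concat d x s = d n u" "infinite_concat d x t = d m v"
      then have "n = m \<and> u = v" using eq by (intro earring_loop_inj) auto
      then show ?thesis using h by simp
    qed (use nz eq in \<open>auto\<close>)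
  qed (use path_image_earring_loop_inf that in \<open>auto simp: path_image_def\<close>)
  have zero: "(0, 0) \<in> earring" "g (0, 0) = x"
  proof -
    have one: "earring_loop_inf 1 = (0, 0)" by (simp add: earring_loop_inf_eq)
    moreover have "earring_loop_inf 1 \<in> earring_loop_inf ` {0..1}" by (intro imageI) auto
    ultimately show "(0, 0) \<in> earring"
      using path_image_earring_loop_inf unfolding path_image_def by simp
    show "g (0, 0) = x" using g(2)[rule_format, of 1] one by simp
  qed
  define f where "f z = (if z \<in> earring then g z else \<alpha> (fst z + 1))" for z
  have f_segment: "f z = \<alpha> (fst z + 1)" if "z \<in> {-1..0} \<times> {0}" for z
  proof (cases "z \<in> earring")
    case True
    then have "z = (0, 0)" using earring_origin that by auto
    then show ?thesis using zero a by (simp add: f_def pathfinish_def)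
  qed (simp add: f_def)
  have f_inf: "\<forall>t\<in>{0..1}. f (earring_loop_inf t) = infinite_concat d x t"
    using g(2) path_image_earring_loop_inf by (auto simp: f_def path_image_def)
  have "continuous_on earring_plus f"
    unfolding earring_plus_def
  proof (rule continuous_on_closed_Un)
    show "closed earring"
      using compact_path_image[OF path_earring_loop_inf] path_image_earring_loop_inf
      by (simp add: compact_imp_closed)
    show "closed ({-1..0::real} \<times> {0::real})" by (intro closed_Times) auto
    show "continuous_on earring f" using g(1) by (rule continuous_on_eq) (simp add: f_def)
    have "continuous_on ({-1..0} \<times> {0::real}) (\<lambda>z. \<alpha> (fst z + 1))"
    proof -
      have "continuous_on {0..1} \<alpha>" using a by (simp add: path_def)
      moreover have "continuous_on ({-1..0} \<times> {0::real}) (\<lambda>z. fst z + 1 :: real)"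
        by (intro continuous_intros)
      moreover have "(\<lambda>z. fst z + 1) ` ({-1..0} \<times> {0::real}) \<subseteq> {0..1::real}" by auto
      ultimately show ?thesis by (rule continuous_on_compose2)
    qed
    then show "continuous_on ({-1..0} \<times> {0}) f"
      by (rule continuous_on_eq) (simp add: f_segment)
  qed
  moreover have "f z \<in> X" if "z \<in> earring_plus" for z
  proof (cases "z \<in> earring")
    case True
    then obtain t where "t \<in> {0..1}" "z = earring_loop_inf t"
      using path_image_earring_loop_inf unfolding path_image_def by blast
    then show ?thesis using f_inf qX by (auto simp: path_image_def)
  next
    case False
    then have z: "z \<in> {-1..0} \<times> {0}" using that by (simp add: earring_plus_def)
    then have "fst z + 1 \<in> {0..1}" by auto
    then show ?thesis using a f_segment[OF z] by (auto simp: path_image_def)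
  qed
  moreover have "f (-1, 0) = x\<^sub>0"
    using f_segment[of "(-1, 0)"] a by (simp add: pathstart_def)
  moreover have "f (whisker t) = \<alpha> t" if "t \<in> {0..1}" for t
    using f_segment[of "whisker t"] that by (simp add: whisker_def)
  moreover have "f (earring_loop n u) = d n u" if n: "n \<ge> 1" and u: "u \<in> {0..1}" for n u
  proof -
    have "earring_loop n u = earring_loop_inf (piece_time n u)"
      unfolding earring_loop_inf_eq by (rule infinite_concat_piece_time[OF n u, symmetric]) simp
    moreover have "infinite_concat d x (piece_time n u) = d n u"
      using d_ends n by (intro infinite_concat_piece_time[OF n u]) simp
    ultimately show ?thesis using f_inf piece_time_bounds(3)[OF n u] by metis
  qed
  ultimately show ?thesis using that f_inf by blast
qed

section \<open>The telescoping product\<close>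

text \<open>The two ways around the boundary of a square are homotopic in the square, which is
  convex.\<close>

lemma homotopic_paths_square:
  assumes H: "continuous_on ({0..1} \<times> {0..1}) H" "H ` ({0..1} \<times> {0..1}) \<subseteq> X"
  shows "homotopic_paths X ((\<lambda>t. H (0, t)) +++ (\<lambda>s. H (s, 1))) ((\<lambda>s. H (s, 0)) +++ (\<lambda>t. H (1, t)))"
proof -
  let ?p = "(\<lambda>t. (0, t)) +++ (\<lambda>s. (s, 1))" and ?q = "(\<lambda>s. (s, 0)) +++ (\<lambda>t. (1, t))"
  let ?S = "{0..1} \<times> {0..1} :: (real \<times> real) set"
  have "path ?p" "path ?q"
    by (intro path_join_imp; simp add: path_def pathstart_def pathfinish_def continuous_intros)+
  moreover have "?p t \<in> ?S" "?q t \<in> ?S" if "t \<in> {0..1}" for t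
    using that by (auto simp: joinpaths_def)
  moreover have "convex ?S" by (intro convex_Times convex_real_interval)
  ultimately have "homotopic_paths ?S ?p ?q"
    by (intro homotopic_paths_linear closed_segment_subset)
      (auto simp: pathstart_def pathfinish_def joinpaths_def)
  then have "homotopic_paths X (H \<circ> ?p) (H \<circ> ?q)"
    using H by (intro homotopic_paths_continuous_image[of ?S]) auto
  then show ?thesis unfolding path_compose_join by (simp add: o_def)
qed

text \<open>At stage \<open>s\<close> of the homotopy each loop \<open>\<delta> n\<close> is replaced by its restriction to
  \<open>{s..1}\<close>.  Consecutive pieces still fit together, the pieces shrink uniformly in \<open>s\<close>, and
  the product is constant at \<open>s = 1\<close>, while its starting point runs along \<open>\<delta> 1\<close>.  Moving
  the starting point instead of fixing it avoids regrouping infinitely many factors.\<close>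

lemma infinite_concat_telescopes:
  fixes X :: "'a::metric_space set"
  assumes \<delta>: "\<And>n. \<delta> n \<in> paths_between X x x"
    and small: "\<And>e. e > 0 \<Longrightarrow> \<exists>M. \<forall>n\<ge>M. \<forall>u\<in>{0..1}. dist (\<delta> n u) x < e"
  shows "path_class X (infinite_concat (\<lambda>n. \<delta> n +++ reversepath (\<delta> (Suc n))) x) = path_class X (\<delta> 1)"
proof -
  have x: "x \<in> X" using \<delta>[of 0] by (auto simp: pathfinish_in_path_image)
  have ends: "\<delta> n 0 = x" "\<delta> n 1 = x" for n using \<delta>[of n] by (auto simp: pathstart_def pathfinish_def)
  have cont: "continuous_on {0..1} (\<delta> n)" for n using \<delta>[of n] by (simp add: path_def)
  define h where "h n s u = (if u \<le> 1/2 then \<delta> n (s + (1 - s) * (2 * u))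
      else \<delta> (Suc n) (s + (1 - s) * (2 - 2 * u)))" for n and s u :: real
  have arg: "s + (1 - s) * c \<in> {0..1}" if "s \<in> {0..1}" "c \<in> {0..1}" for s c :: real
  proof -
    have "(1 - s) * c \<le> (1 - s) * 1" using that by (intro mult_left_mono) auto
    moreover have "0 \<le> (1 - s) * c" using that by simp
    ultimately show ?thesis using that by auto
  qed
  have h_mem: "h n s u \<in> \<delta> n ` {0..1} \<union> \<delta> (Suc n) ` {0..1}" if "s \<in> {0..1}" "u \<in> {0..1}" for n s u
    using that arg[of s "2 * u"] arg[of s "2 - 2 * u"] unfolding h_def by auto
  let ?H = "\<lambda>p. infinite_concat (\<lambda>n. h n (fst p)) x (snd p)"
  have contH: "continuous_on ({0..1} \<times> {0..1}) ?H"
  proof (rule continuous_on_infinite_concat)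
    show "closed {0..1::real}" by simp
    show "h n s 1 = h (Suc n) s 0" for n s by (simp add: h_def)
    show "continuous_on ({0..1} \<times> {0..1}) (\<lambda>p. h n (fst p) (snd p))" for n
      unfolding h_def
    proof (rule continuous_on_cases_le)
      show "continuous_on {p \<in> {0..1} \<times> {0..1}. snd p \<le> 1/2} (\<lambda>p. \<delta> n (fst p + (1 - fst p) * (2 * snd p)))"
      proof (rule continuous_on_compose2[OF cont])
        have "fst p + (1 - fst p) * (2 * snd p) \<in> {0..1}"
          if "p \<in> {p \<in> {0..1} \<times> {0..1}. snd p \<le> 1/2}" for p :: "real \<times> real"
          using that by (intro arg) auto
        then show "(\<lambda>p. fst p + (1 - fst p) * (2 * snd p)) ` {p \<in> {0..1} \<times> {0..1}. snd p \<le> 1/2} \<subseteq> {0..1::real}"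
          by blast
      qed (intro continuous_intros)
      show "continuous_on {p \<in> {0..1} \<times> {0..1}. 1/2 \<le> snd p}
          (\<lambda>p. \<delta> (Suc n) (fst p + (1 - fst p) * (2 - 2 * snd p)))"
      proof (rule continuous_on_compose2[OF cont])
        have "fst p + (1 - fst p) * (2 - 2 * snd p) \<in> {0..1}"
          if "p \<in> {p \<in> {0..1} \<times> {0..1}. 1/2 \<le> snd p}" for p :: "real \<times> real"
          using that by (intro arg) auto
        then show "(\<lambda>p. fst p + (1 - fst p) * (2 - 2 * snd p)) ` {p \<in> {0..1} \<times> {0..1}. 1/2 \<le> snd p} \<subseteq> {0..1::real}"
          by blast
      qed (intro continuous_intros)
      show "continuous_on ({0..1} \<times> {0..1}) (snd :: real \<times> real \<Rightarrow> real)" by (intro continuous_intros)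
      show "\<delta> n (fst p + (1 - fst p) * (2 * snd p)) = \<delta> (Suc n) (fst p + (1 - fst p) * (2 - 2 * snd p))"
        if "snd p = 1/2" for p :: "real \<times> real"
      proof -
        have "2 * snd p = 1" "2 - 2 * snd p = 1" using that by simp_all
        then show ?thesis using ends by simp
      qed
    qed
    fix e :: real assume "e > 0"
    then obtain M where M: "\<forall>n\<ge>M. \<forall>u\<in>{0..1}. dist (\<delta> n u) x < e" using small by blast
    have "dist (h n s u) x < e" if "n \<ge> M" "s \<in> {0..1}" "u \<in> {0..1}" for n s u
    proof -
      have "Suc n \<ge> M" using that by simp
      then show ?thesis using h_mem[OF that(2,3), of n] M that(1) by fastforce
    qed
    then show "\<exists>M. \<forall>n\<ge>M. \<forall>s\<in>{0..1}. \<forall>u\<in>{0..1}. dist (h n s u) x < e" by blast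
  qed
  have HX: "?H ` ({0..1} \<times> {0..1}) \<subseteq> X"
  proof -
    have "infinite_concat (\<lambda>n. h n s) x t \<in> X" if s: "s \<in> {0..1}" and t: "t \<in> {0..1}" for s t
    proof -
      have "path_image (h n s) \<subseteq> X" for n
        unfolding path_image_def
      proof (rule image_subsetI)
        fix u :: real assume "u \<in> {0..1}"
        then have "h n s u \<in> path_image (\<delta> n) \<union> path_image (\<delta> (Suc n))"
          using h_mem[OF s] by (simp add: path_image_def)
        moreover have "path_image (\<delta> n) \<subseteq> X" "path_image (\<delta> (Suc n)) \<subseteq> X"
          using \<delta>[of n] \<delta>[of "Suc n"] by simp_all
        ultimately show "h n s u \<in> X" by blast
      qed
      then have "path_image (infinite_concat (\<lambda>n. h n s) x) \<subseteq> X"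
        using x by (intro path_image_infinite_concat)
      then show ?thesis using t by (auto simp: path_image_def)
    qed
    then show ?thesis by auto
  qed
  have bottom: "h n 0 = \<delta> n +++ reversepath (\<delta> (Suc n))" for n
    by (auto simp: h_def joinpaths_def reversepath_def)
  have top: "h n 1 = (\<lambda>_. x)" for n by (auto simp: h_def ends)
  have top': "infinite_concat (\<lambda>n _. x) x = (\<lambda>_. x)"
    by (auto simp: infinite_concat_def Let_def)
  have left: "infinite_concat (\<lambda>n. h n s) x 0 = \<delta> 1 s" for s
    by (simp add: infinite_concat_def h_def)
  let ?q = "infinite_concat (\<lambda>n. \<delta> n +++ reversepath (\<delta> (Suc n))) x"
  have "homotopic_paths X (?q +++ (\<lambda>_. x)) (\<delta> 1 +++ (\<lambda>_. x))"
    using homotopic_paths_square[OF contH HX] by (simp add: bottom top top' left)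
  then have "path_class X (?q +++ (\<lambda>_. x)) = path_class X (\<delta> 1 +++ (\<lambda>_. x))"
    by (rule path_class_eq)
  moreover have "path_class X (p +++ (\<lambda>_. x)) = path_class X p" if "pathfinish p = x" for p
    using that by (simp add: path_class_join path_class_const_right pathstart_def)
  moreover have "pathfinish ?q = x" "pathfinish (\<delta> 1) = x"
    using \<delta>[of 1] by (simp_all add: pathfinish_def)
  ultimately show ?thesis by metis
qed

section \<open>Closed subgroups\<close>

lemma induced_hom_path_class:
  assumes f: "continuous_on S f" "f ` S \<subseteq> X" and p: "path p" "path_image p \<subseteq> S"
  shows "induced_hom X f (path_class S p) = path_class X (f \<circ> p)"
proof -
  have "path_class X (f \<circ> q) = path_class X (f \<circ> p)" if "q \<in> path_class S p" for q
  proof -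
    have "homotopic_paths X (f \<circ> p) (f \<circ> q)"
      using that f by (intro homotopic_paths_continuous_image[of S]) (auto simp: path_class_def)
    then show ?thesis using path_class_eq by blast
  qed
  then show ?thesis using path_class_self[OF p] unfolding induced_hom_def by blast
qed

lemma group_hom_induced_hom:
  assumes f: "continuous_on S f" "f ` S \<subseteq> X" and s: "s \<in> S"
  shows "group_hom (fundamental_group S s) (fundamental_group X (f s)) (induced_hom X f)"
proof -
  have "f s \<in> X" using f s by blast
  have loop: "f \<circ> p \<in> paths_between X (f s) (f s)" if "p \<in> paths_between S s s" for p
    using that f by (auto simp: path_image_compose pathstart_compose pathfinish_compose
        intro: path_continuous_image continuous_on_subset)
  have "induced_hom X f \<in> hom (fundamental_group S s) (fundamental_group X (f s))"
  proof (rule homI)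
    fix c assume "c \<in> carrier (fundamental_group S s)"
    then obtain p where p: "p \<in> paths_between S s s" "c = path_class S p" by auto
    then have c: "induced_hom X f (path_class S p) = path_class X (f \<circ> p)"
      using induced_hom_path_class[OF f] by simp
    then show "induced_hom X f c \<in> carrier (fundamental_group X (f s))"
      unfolding p(2) using path_class_in_carrier[OF loop[OF p(1)]] by simp
    fix d assume "d \<in> carrier (fundamental_group S s)"
    then obtain q where q: "q \<in> paths_between S s s" "d = path_class S q" by auto
    then have d: "induced_hom X f (path_class S q) = path_class X (f \<circ> q)"
      using induced_hom_path_class[OF f] by simp
    have "induced_hom X f (path_class S (p +++ q)) = path_class X (f \<circ> (p +++ q))"
      using p(1) q(1) by (intro induced_hom_path_class[OF f]) (auto simp: path_image_join)
    then show "induced_hom X f (c \<otimes>\<^bsub>fundamental_group S s\<^esub> d)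
        = induced_hom X f c \<otimes>\<^bsub>fundamental_group X (f s)\<^esub> induced_hom X f d"
      using p q by (simp add: c d path_class_join path_compose_join pathstart_compose pathfinish_compose)
  qed
  then show ?thesis
    using group_fundamental_group[OF s] group_fundamental_group[OF \<open>f s \<in> X\<close>]
    by (simp add: group_hom_def group_hom_axioms_def)
qed

lemma induced_hom_generate_subset:
  assumes f: "continuous_on S f" "f ` S \<subseteq> X" and s: "s \<in> S"
    and A: "A \<subseteq> carrier (fundamental_group S s)" "induced_hom X f ` A \<subseteq> K"
    and K: "subgroup K (fundamental_group X (f s))"
  shows "induced_hom X f ` generate (fundamental_group S s) A \<subseteq> K"
proof -
  interpret group_hom "fundamental_group S s" "fundamental_group X (f s)" "induced_hom X f"
    by (rule group_hom_induced_hom[OF f s])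
  show ?thesis
    unfolding generate_img[OF A(1), symmetric] by (rule H.generate_subgroup_incl[OF A(2) K])
qed

lemma test_closed_test_closure:
  assumes s: "s \<in> S" and g: "g \<in> carrier (fundamental_group S s)" and x: "x\<^sub>0 \<in> X"
    and N: "subgroup N (fundamental_group X x\<^sub>0)"
  shows "test_closed S s T g X x\<^sub>0 (test_closure S s T g X x\<^sub>0 N)"
    and "N \<subseteq> test_closure S s T g X x\<^sub>0 N"
proof -
  let ?\<C> = "{K. test_closed S s T g X x\<^sub>0 K \<and> N \<subseteq> K}"
  interpret group "fundamental_group X x\<^sub>0" by (rule group_fundamental_group[OF x])
  have "induced_hom X f g \<in> carrier (fundamental_group X x\<^sub>0)"
    if "continuous_on S f" "f ` S \<subseteq> X" "f s = x\<^sub>0" for f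
    using group_hom.hom_closed[OF group_hom_induced_hom[OF that(1,2) s] g] that(3) by simp
  then have "test_closed S s T g X x\<^sub>0 (carrier (fundamental_group X x\<^sub>0))"
    unfolding test_closed_def using subgroup_self by blast
  then have ne: "?\<C> \<noteq> {}" using subgroup.subset[OF N] by blast
  have "subgroup (\<Inter>?\<C>) (fundamental_group X x\<^sub>0)"
    using ne by (intro subgroups_Inter) (auto simp: test_closed_def)
  moreover have "induced_hom X f g \<in> \<Inter>?\<C>"
    if f: "continuous_on S f \<and> f ` S \<subseteq> X \<and> f s = x\<^sub>0 \<and> induced_hom X f ` T \<subseteq> \<Inter>?\<C>" for f
  proof (rule InterI)
    fix K assume K: "K \<in> ?\<C>"
    then have "\<Inter>?\<C> \<subseteq> K" by (rule Inter_lower)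
    then have "induced_hom X f ` T \<subseteq> K" using f by (meson subset_trans)
    moreover have "test_closed S s T g X x\<^sub>0 K" using K by simp
    ultimately show "induced_hom X f g \<in> K" using f unfolding test_closed_def by simp
  qed
  ultimately show "test_closed S s T g X x\<^sub>0 (test_closure S s T g X x\<^sub>0 N)"
    unfolding test_closure_def test_closed_def[of _ _ _ _ _ _ "\<Inter>?\<C>"] by (intro conjI allI impI)
  show "N \<subseteq> test_closure S s T g X x\<^sub>0 N"
    unfolding test_closure_def by blast
qed

lemma path_class_compose_whiskered:
  assumes a: "\<alpha> \<in> paths_between X x\<^sub>0 x" and q: "q \<in> paths_between X x x"
    and fw: "\<forall>t\<in>{0..1}. f (w t) = \<alpha> t" and fl: "\<forall>t\<in>{0..1}. f (l t) = q t"
  shows "path_class X (f \<circ> (w +++ l +++ reversepath w)) = path_class X (\<alpha> +++ q +++ reversepath \<alpha>)"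
proof (rule sym, rule path_class_eq, rule homotopic_paths_eq)
  show "path (\<alpha> +++ q +++ reversepath \<alpha>)" "path_image (\<alpha> +++ q +++ reversepath \<alpha>) \<subseteq> X"
    using a q by (auto simp: path_image_join)
  show "(\<alpha> +++ q +++ reversepath \<alpha>) t = (f \<circ> (w +++ l +++ reversepath w)) t" if "t \<in> {0..1}" for t
    using that fw fl by (auto simp: joinpaths_def reversepath_def)
qed

lemma whisker_paths_between: "whisker \<in> paths_between earring_plus (-1, 0) (0, 0)"
proof -
  have "path whisker" unfolding path_def whisker_def by (intro continuous_intros)
  moreover have "path_image whisker \<subseteq> earring_plus"
    by (auto simp: path_image_def whisker_def earring_plus_def)
  ultimately show ?thesis by (simp add: pathstart_def pathfinish_def whisker_def)
qed

lemma earring_loops_paths_between: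
  shows "n \<ge> 1 \<Longrightarrow> earring_loop n \<in> paths_between earring_plus (0, 0) (0, 0)"
    and "earring_loop_inf \<in> paths_between earring_plus (0, 0) (0, 0)"
proof -
  show "earring_loop n \<in> paths_between earring_plus (0, 0) (0, 0)" if "n \<ge> 1"
  proof -
    have "path_image (earring_loop n) \<subseteq> earring_plus"
      using earring_loop_in_circle[OF that] that unfolding earring_plus_def earring_def path_image_def by auto
    then show ?thesis using path_earring_loop by (simp add: pathstart_def pathfinish_def)
  qed
  have "infinite_concat earring_loop (0, 0) 0 = (0, 0)" by (simp add: infinite_concat_def)
  then show "earring_loop_inf \<in> paths_between earring_plus (0, 0) (0, 0)"
    using path_earring_loop_inf path_image_earring_loop_inf
    by (auto simp: earring_plus_def pathstart_def pathfinish_def earring_loop_inf_eq)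
qed

text \<open>If the coset of \<open>\<gamma>\<close> contains loops \<open>\<delta> n\<close> shrinking to a point, then the map that
  sends the \<open>n\<close>-th circle along \<open>\<delta> n +++ reversepath (\<delta> (Suc n))\<close> takes the generators of
  the earring subgroup into \<open>K\<close>.  The infinite earring loop goes to the telescoping product, that
  is, to \<open>\<delta> 1\<close>.  Closedness thus puts \<open>\<delta> 1\<close>, and with it \<open>\<gamma>\<close>, into the conjugate of
  \<open>K\<close>.\<close>

theorem homotopically_Hausdorff_rel_if_test_closed:
  fixes X :: "'a::metric_space set"
  assumes closed: "test_closed earring_plus (-1, 0) earring_subgroup earring_class_inf X x\<^sub>0 K"
  shows "homotopically_Hausdorff_rel X x\<^sub>0 K"
proof -
  have K: "subgroup K (fundamental_group X x\<^sub>0)" using closed by (simp add: test_closed_def)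
  show ?thesis
    unfolding homotopically_Hausdorff_rel_iff[OF K]
  proof (intro ballI impI, rule ccontr)
    fix x \<alpha> \<gamma>
    assume x: "x \<in> X" and a: "\<alpha> \<in> paths_between X x\<^sub>0 x" and g: "\<gamma> \<in> paths_between X x x"
      and notin: "path_class X (\<alpha> +++ \<gamma> +++ reversepath \<alpha>) \<notin> K"
      and "\<nexists>U. openin (top_of_set X) U \<and> x \<in> U \<and>
        (\<forall>\<delta>\<in>paths_between U x x. path_class X (\<alpha> +++ \<gamma> +++ reversepath \<delta> +++ reversepath \<alpha>) \<notin> K)"
    then have "\<exists>\<delta>\<in>paths_between (X \<inter> ball x (1 / real (Suc n))) x x.
        path_class X (\<alpha> +++ \<gamma> +++ reversepath \<delta> +++ reversepath \<alpha>) \<in> K" for n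
      using openin_open_Int[OF open_ball, of X x "1 / real (Suc n)"] by auto
    then obtain \<delta> where \<delta>: "\<And>n. \<delta> n \<in> paths_between (X \<inter> ball x (1 / real (Suc n))) x x"
        and in_K: "\<And>n. path_class X (\<alpha> +++ \<gamma> +++ reversepath (\<delta> n) +++ reversepath \<alpha>) \<in> K"
      by metis
    have \<delta>X: "\<delta> n \<in> paths_between X x x" for n using \<delta>[of n] by auto
    have small: "\<exists>M. \<forall>n\<ge>M. \<forall>u\<in>{0..1}. dist (\<delta> n u) x < e" if e: "e > 0" for e
    proof -
      obtain M where M: "1 / real (Suc M) < e" using nat_approx_posE[OF e] .
      have "dist (\<delta> n u) x < e" if "n \<ge> M" "u \<in> {0..1}" for n u
      proof -
        have "\<delta> n u \<in> ball x (1 / real (Suc n))" 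
          using \<delta>[of n] that(2) unfolding paths_between_iff path_image_def by blast
        moreover have "1 / real (Suc n) \<le> 1 / real (Suc M)" using that(1) by (intro divide_left_mono) auto
        ultimately show ?thesis using M by (simp add: dist_commute)
      qed
      then show ?thesis by blast
    qed
    define d where "d n = \<delta> n +++ reversepath (\<delta> (Suc n))" for n
    have d: "d n \<in> paths_between X x x" for n
      using \<delta>X[of n] \<delta>X[of "Suc n"] by (simp add: d_def path_image_join)
    have d_small: "\<exists>M. \<forall>n\<ge>M. \<forall>u\<in>{0..1}. dist (d n u) x < e" if e: "e > 0" for e
    proof -
      obtain M where M: "\<forall>n\<ge>M. \<forall>u\<in>{0..1}. dist (\<delta> n u) x < e" using small[OF e] by blast
      have "dist (d n u) x < e" if "n \<ge> M" "u \<in> {0..1}" for n u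
        using M[rule_format, of n "2 * u"] M[rule_format, of "Suc n" "1 - (2 * u - 1)"] that
        by (auto simp: d_def joinpaths_def reversepath_def)
      then show ?thesis by blast
    qed
    have conj_d: "path_class X (\<alpha> +++ d n +++ reversepath \<alpha>) \<in> K" for n
    proof -
      have p: "\<alpha> +++ \<gamma> \<in> paths_between X x\<^sub>0 x" "\<alpha> +++ \<delta> n \<in> paths_between X x\<^sub>0 x" for n
        using a g \<delta>X[of n] by (auto simp: path_image_join)
      have "path_class X ((\<alpha> +++ \<gamma>) +++ reversepath (\<alpha> +++ \<delta> n)) \<in> K" for n
        using in_K[of n] a g \<delta>X[of n] by (simp add: groupoid_simps)
      then have "path_class X ((\<alpha> +++ \<delta> n) +++ reversepath (\<alpha> +++ \<delta> (Suc n))) \<in> K"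
        using class_quotient_sym[OF K p(1) p(2) p(2)] class_quotient_trans[OF K p(2) p(1) p(2)] by blast
      then show ?thesis using a \<delta>X[of n] \<delta>X[of "Suc n"] by (simp add: d_def groupoid_simps)
    qed
    obtain f where f: "continuous_on earring_plus f" "f ` earring_plus \<subseteq> X" "f (-1, 0) = x\<^sub>0"
        "\<forall>t\<in>{0..1}. f (whisker t) = \<alpha> t"
        "\<forall>n\<ge>1. \<forall>u\<in>{0..1}. f (earring_loop n u) = d n u"
        "\<forall>t\<in>{0..1}. f (earring_loop_inf t) = infinite_concat d x t"
      using earring_plus_map[OF a d d_small] by metis
    note f' = f(1,2)
    have w: "whisker +++ l +++ reversepath whisker \<in> paths_between earring_plus (-1, 0) (-1, 0)"
      if "l \<in> paths_between earring_plus (0, 0) (0, 0)" for l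
      using that whisker_paths_between by (simp add: path_image_join)
    have base: "(-1, 0) \<in> earring_plus" by (simp add: earring_plus_def)
    have image: "induced_hom X f (path_class earring_plus (whisker +++ l +++ reversepath whisker))
        = path_class X (\<alpha> +++ q +++ reversepath \<alpha>)"
      if "l \<in> paths_between earring_plus (0, 0) (0, 0)" "q \<in> paths_between X x x"
        "\<forall>t\<in>{0..1}. f (l t) = q t" for l q
      using induced_hom_path_class[OF f'] w[OF that(1)]
        path_class_compose_whiskered[where f = f and w = whisker and l = l, OF a that(2) f(4) that(3)] by simp
    have "induced_hom X f ` earring_subgroup \<subseteq> K"
      unfolding earring_subgroup_def
    proof (rule induced_hom_generate_subset[OF f' base])
      show "earring_class ` {1..} \<subseteq> carrier (fundamental_group earring_plus (- 1, 0))"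
        unfolding earring_class_def
        using path_class_in_carrier[OF w[OF earring_loops_paths_between(1)]] by auto
      have "induced_hom X f (earring_class n) \<in> K" if "n \<ge> 1" for n
        unfolding earring_class_def
        using image[OF earring_loops_paths_between(1)[OF that] d f(5)[THEN spec, THEN mp, OF that]]
          conj_d by simp
      then show "induced_hom X f ` earring_class ` {1..} \<subseteq> K" by auto
    qed (use f(3) K in simp)
    then have inf_in_K: "induced_hom X f earring_class_inf \<in> K"
      using closed f' f(3) unfolding test_closed_def by blast
    have q: "infinite_concat d x \<in> paths_between X x x"
    proof -
      have "path (infinite_concat d x)" using d d_small by (intro path_infinite_concat) auto
      moreover have "path_image (infinite_concat d x) \<subseteq> X"
        using d x by (intro path_image_infinite_concat) auto
      moreover have "infinite_concat d x 0 = x"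
        using d[of 1] by (simp add: infinite_concat_def pathstart_def)
      ultimately show ?thesis by (simp add: pathstart_def pathfinish_def)
    qed
    have "path_class X (\<alpha> +++ infinite_concat d x +++ reversepath \<alpha>) \<in> K"
      using inf_in_K image[OF earring_loops_paths_between(2) q f(6)] by (simp add: earring_class_inf_def)
    moreover have "path_class X (infinite_concat d x) = path_class X (\<delta> 1)"
      unfolding d_def[abs_def] by (rule infinite_concat_telescopes[OF \<delta>X small])
    ultimately have "path_class X (\<alpha> +++ \<delta> 1 +++ reversepath \<alpha>) \<in> K"
      using a q \<delta>X[of 1] by (simp add: groupoid_simps)
    from subgroup.m_closed[OF K in_K[of 1] this]
    have "path_class X (\<alpha> +++ \<gamma> +++ reversepath \<alpha>) \<in> K"
      using a g \<delta>X[of 1] by (simp add: groupoid_simps)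
    then show False using notin by blast
  qed
qed

theorem corollary7p15:
  fixes X :: "'a::metric_space set" and x\<^sub>0 :: 'a and N :: "(real \<Rightarrow> 'a) set set"
  assumes "path_connected X"
    and "x\<^sub>0 \<in> X"
    and "discrete (wild_set X)"
    and "subgroup N (fundamental_group X x\<^sub>0)"
    and "derived (fundamental_group X x\<^sub>0) (carrier (fundamental_group X x\<^sub>0)) \<subseteq> N"
  shows "(unique_path_lifting (lift_space X x\<^sub>0 N) endpoint_proj
            \<longleftrightarrow> homotopically_Hausdorff_rel X x\<^sub>0 N)
       \<and> (\<forall>K. K = test_closure earring_plus (-1, 0) earring_subgroup earring_class_inf X x\<^sub>0 N
            \<longrightarrow> unique_path_lifting (lift_space X x\<^sub>0 K) endpoint_proj)"
proof (intro conjI allI impI)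
  show "unique_path_lifting (lift_space X x\<^sub>0 N) endpoint_proj \<longleftrightarrow> homotopically_Hausdorff_rel X x\<^sub>0 N"
    using homotopically_Hausdorff_rel_if_unique_path_lifting[OF assms(4)]
      unique_path_lifting_if_homotopically_Hausdorff_rel[OF assms(4,5,3)] by blast
next
  fix K assume K: "K = test_closure earring_plus (-1, 0) earring_subgroup earring_class_inf X x\<^sub>0 N"
  have base: "(-1, 0) \<in> earring_plus" by (simp add: earring_plus_def)
  have inf: "earring_class_inf \<in> carrier (fundamental_group earring_plus (-1, 0))"
    unfolding earring_class_inf_def using whisker_paths_between earring_loops_paths_between(2)
    by (intro path_class_in_carrier) (simp add: path_image_join)
  have closed: "test_closed earring_plus (-1, 0) earring_subgroup earring_class_inf X x\<^sub>0 K"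
    and NK: "N \<subseteq> K"
    unfolding K by (rule test_closed_test_closure[OF base inf assms(2,4)])+
  then have "subgroup K (fundamental_group X x\<^sub>0)" by (simp add: test_closed_def)
  moreover have "derived (fundamental_group X x\<^sub>0) (carrier (fundamental_group X x\<^sub>0)) \<subseteq> K"
    using assms(5) NK by blast
  ultimately show "unique_path_lifting (lift_space X x\<^sub>0 K) endpoint_proj"
    using assms(3) homotopically_Hausdorff_rel_if_test_closed[OF closed]
    by (rule unique_path_lifting_if_homotopically_Hausdorff_rel)
qed

end
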